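(* Let $n\ge1$ be an integer, $0<s<1$ and $0<\alpha\le 1$. Let $f:\mathbb R\to\mathbb R$ and $g:[0,+\infty)\to\mathbb R$ satisfy: (F1) $f$ is strictly increasing and $\limsup_{x_1\to-\infty} f(x_1)|x_1|^{2s}\le 0$; (F2) $g$ is locally Lipschitz and nondecreasing in $(0,+\infty)$; moreover $g'(u)$ is continuous near $u=0$, $g(0)=0$, $g'(0)=0$, and $g(u)>0$ for $u\in(0,+\infty)$. Suppose further that $\lim_{x_1\to+\infty}f(x_1)=+\infty$. Then the equation $$\partial_t^\alpha u(x,t)+(-\Delta)^s u(x,t)-\Delta u(x,t)=f(x_1)\,g(u(x,t)),\qquad (x,t)\in\mathbb R^n\times\mathbb R,$$ possesses no positive bounded classical solution $u\in (C^2(\mathbb R^n)\cap\tilde{\mathcal L}_{2s})\times(C^1(\mathbb R)\cap\mathcal L^-_\alpha(\mathbb R))$ that is uniformly continuous.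
   Context: Here $x=(x_1,\dots,x_n)$, and $\Delta$ and $(-\Delta)^s$ act in $x$ for fixed $t$, with $$(-\Delta)^s u(x,t)=C_{n,s}\lim_{\varepsilon\to0}\int_{\mathbb R^n\setminus B_\varepsilon(x)}\frac{u(x,t)-u(y,t)}{|x-y|^{n+2s}}\,dy,\qquad C_{n,s}=\frac{4^s s\,\Gamma(\frac{n+2s}{2})}{\pi^{n/2}\Gamma(1-s)}.$$ For $0<\alpha<1$, $\partial_t^\alpha$ is the Marchaud fractional derivative $$\partial_t^\alpha u(x,t)=C_\alpha\int_{-\infty}^t\frac{u(x,t)-u(x,\tau)}{(t-\tau)^{1+\alpha}}\,d\tau,\qquad C_\alpha=\frac{\alpha}{\Gamma(1-\alpha)},$$ and for $\alpha=1$ it is the classical derivative $\partial_t u$. The notation $u\in (C^2(\mathbb R^n)\cap\tilde{\mathcal L}_{2s})\times(C^1(\mathbb R)\cap\mathcal L^-_\alpha(\mathbb R))$ means that $u(\cdot,t)$ belongs to the first space for each $t$ and $u(x,\cdot)$ belongs to the second space for each $x$. Here $\tilde{\mathcal L}_{2s}$ is the set of $u(\cdot,t)\in L^1_{loc}(\mathbb R^n)$ with $\int_{\mathbb R^n}\frac{|u(x,t)|}{1+|x|^{n+2s}}dx<+\infty$, and $\mathcal L^-_\alpha(\mathbb R)$ is the set of $u\in L^1_{loc}(\mathbb R)$ with $\int_{-\infty}^t\frac{|u(\tau)|}{1+|\tau|^{1+\alpha}}d\tau<+\infty$ for each $t\in\mathbb R$. A classical solution is a function in this class satisfying the equation pointwise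 in $\mathbb R^n\times\mathbb R$. "Positive" means $u>0$ everywhere. *)

theory Defs
  imports "HOL-Analysis.Analysis"
begin

definition partial_deriv :: "'n::finite \<Rightarrow> (real^'n \<Rightarrow> real) \<Rightarrow> real^'n \<Rightarrow> real" where
  "partial_deriv i v x = deriv (\<lambda>h. v (x + h *\<^sub>R axis i 1)) 0"

definition laplacian :: "(real^'n::finite \<Rightarrow> real) \<Rightarrow> real^'n \<Rightarrow> real" where
  "laplacian v x = (\<Sum>i\<in>UNIV. partial_deriv i (partial_deriv i v) x)"

definition C2_space :: "(real^'n::finite \<Rightarrow> real) set" where
  "C2_space = {v. (\<forall>x. v differentiable (at x)) \<and>
     (\<forall>i x. partial_deriv i v differentiable (at x)) \<and>
     (\<forall>i j. continuous_on UNIV (partial_deriv i (partial_deriv j v)))}"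

definition L1_loc :: "('a::euclidean_space \<Rightarrow> real) set" where
  "L1_loc = {v. \<forall>K. compact K \<longrightarrow> set_integrable lebesgue K v}"

definition L_frac_space :: "real \<Rightarrow> (real^'n::finite \<Rightarrow> real) set" where
  "L_frac_space s = {v \<in> L1_loc.
     integrable lebesgue (\<lambda>x. \<bar>v x\<bar> / (1 + norm x powr (real CARD('n) + 2 * s)))}"

definition L_past_space :: "real \<Rightarrow> (real \<Rightarrow> real) set" where
  "L_past_space \<alpha> = {w \<in> L1_loc.
     \<forall>t. set_integrable lebesgue {..t} (\<lambda>\<tau>. \<bar>w \<tau>\<bar> / (1 + \<bar>\<tau>\<bar> powr (1 + \<alpha>)))}"

definition frac_laplacian_const :: "nat \<Rightarrow> real \<Rightarrow> real" where
  "frac_laplacian_const n s =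
     4 powr s * s * Gamma ((real n + 2 * s) / 2) / (pi powr (real n / 2) * Gamma (1 - s))"

(* Lim and the Bochner integral are total.  For v in C2_space and L_frac_space s with
   0 < s < 1 the truncated integrals converge absolutely and the limit exists, so no
   junk value occurs on the class of functions considered below. *)
definition frac_laplacian :: "real \<Rightarrow> (real^'n::finite \<Rightarrow> real) \<Rightarrow> real^'n \<Rightarrow> real" where
  "frac_laplacian s v x = frac_laplacian_const CARD('n) s *
     Lim (at_right 0) (\<lambda>\<epsilon>. LINT y : (- ball x \<epsilon>) | lebesgue.
       (v x - v y) / norm (x - y) powr (real CARD('n) + 2 * s))"

(* For 0 < \<alpha> < 1 and w of class C^1 in L_past_space \<alpha> the integral converges absolutely. *)
definition marchaud_deriv :: "real \<Rightarrow> (real \<Rightarrow> real) \<Rightarrow> real \<Rightarrow> real" where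
  "marchaud_deriv \<alpha> w t = \<alpha> / Gamma (1 - \<alpha>) *
     (LINT \<tau> : {..<t} | lebesgue. (w t - w \<tau>) / (t - \<tau>) powr (1 + \<alpha>))"

definition frac_time_deriv :: "real \<Rightarrow> (real \<Rightarrow> real) \<Rightarrow> real \<Rightarrow> real" where
  "frac_time_deriv \<alpha> w t = (if \<alpha> = 1 then deriv w t else marchaud_deriv \<alpha> w t)"

(* The index k :: 'n names the distinguished coordinate x_1. *)
definition classical_solution ::
    "'n::finite \<Rightarrow> real \<Rightarrow> real \<Rightarrow> (real \<Rightarrow> real) \<Rightarrow> (real \<Rightarrow> real) \<Rightarrow> (real^'n \<Rightarrow> real \<Rightarrow> real) \<Rightarrow> bool" where
  "classical_solution k s \<alpha> f g u \<longleftrightarrow>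
     (\<forall>t. (\<lambda>x. u x t) \<in> C2_space \<inter> L_frac_space s) \<and>
     (\<forall>x. u x C1_differentiable_on UNIV \<and> u x \<in> L_past_space \<alpha>) \<and>
     (\<forall>x t. frac_time_deriv \<alpha> (u x) t + frac_laplacian s (\<lambda>y. u y t) x - laplacian (\<lambda>y. u y t) x
        = f (x $ k) * g (u x t))"

definition condition_F1 :: "real \<Rightarrow> (real \<Rightarrow> real) \<Rightarrow> bool" where
  "condition_F1 s f \<longleftrightarrow> strict_mono f \<and> Limsup at_bot (\<lambda>r. ereal (f r * \<bar>r\<bar> powr (2 * s))) \<le> 0"

(* g is a function on [0, \<infinity>): only its values there are used, and the derivative at 0 is
   one-sided. *)
definition condition_F2 :: "(real \<Rightarrow> real) \<Rightarrow> bool" where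
  "condition_F2 g \<longleftrightarrow>
     local_lipschitz (UNIV :: real set) {0<..} (\<lambda>_. g) \<and> mono_on {0<..} g \<and>
     (\<exists>\<delta>>0. \<exists>g'. (\<forall>r\<in>{0..<\<delta>}. (g has_real_derivative g' r) (at r within {0..})) \<and>
        continuous_on {0..<\<delta>} g' \<and> g' 0 = 0) \<and>
     g 0 = 0 \<and> (\<forall>r>0. g r > 0)"

end

theory Submission
  imports Defs
begin

text \<open>
The proof is the method of moving planes, followed by a comparison far to the right.

Write \<open>e\<close> for the distinguished coordinate direction and, for a plane \<open>x \<bullet> e = l\<close>, let
\<open>w(x,t) = u(x',t) - u(x,t)\<close>, where \<open>x'\<close> is the mirror image of \<open>x\<close>.  The function \<open>w\<close> is
antisymmetric, and the claim is that \<open>w \<ge> 0\<close> on the left of the plane, for every \<open>l\<close>; so \<open>u\<close> is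
nondecreasing along \<open>e\<close>.  Once this is known, \<open>u\<close> is bounded below by a positive constant \<open>b\<close> on
the unit balls centred at \<open>R e\<close> for times in \<open>[-1,1]\<close>, uniformly in \<open>R \<ge> 0\<close>, whence the right-hand
side of the equation is at least \<open>f(R - 1) g(b)\<close> there and tends to infinity with \<open>R\<close>.  But a bounded
nonnegative function is touched from below, somewhere in such a cylinder, by a paraboloid of fixed
height, and at the touching point the left-hand side is bounded independently of \<open>R\<close>.

For the sign of \<open>w\<close>, put \<open>m = - inf w\<close> and suppose that \<open>m > 0\<close>.  The infimum need not be attained, but
a small paraboloid, with a space scale comparable to the distance to the plane and the matching time
scale, touches \<open>w\<close> from below at a point at distance \<open>d\<close> from the plane where \<open>w\<close> is almost \<open>- m\<close>.  At
this point the antisymmetry forces the fractional Laplacian of \<open>w\<close> to be at most \<open>- c m d powr (- 2 s)\<close>,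
while all errors are smaller than this (\<open>reflection_minimum_principle\<close>).  The equation turns this into
\<open>(f(x' \<bullet> e) - f(x \<bullet> e)) g(u(x')) + c m d powr (- 2 s) \<le> f(x \<bullet> e) (g(u(x)) - g(u(x'))) \<le> f(x \<bullet> e) \<Lambda> m\<close>,
with a Lipschitz constant \<open>\<Lambda>\<close> of \<open>g\<close>.  The second term on the left excludes points far to the left, by the
decay of \<open>f\<close>; points close to the plane, as \<open>d powr (- 2 s)\<close> is large there; and, among the points at
a bounded distance from the plane, those at which \<open>u\<close> is small, as the slope of \<open>g\<close> vanishes at \<open>0\<close>.
In the remaining region the first term is bounded below, because \<open>f\<close> is strictly increasing and \<open>u\<close> is
not small, so that \<open>m\<close> cannot be small.  Hence for all
\<open>l \<le> l0\<close> either \<open>m = 0\<close> or \<open>m\<close> exceeds a constant depending on \<open>l0\<close> alone, and \<open>m = 0\<close> when \<open>l\<close> is very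
negative (\<open>plane_dichotomy\<close>).  By uniform continuity \<open>m\<close> cannot jump as the plane moves, so it
stays \<open>0\<close> for every \<open>l\<close>.  This replaces the usual compactness argument by explicit estimates, and no
regularity theory enters.
\<close>

section \<open>Integrals of the truncated Riesz kernel\<close>

text \<open>
One kernel serves both nonlocal operators: \<open>\<beta> = 2 s\<close> in space and \<open>\<beta> = \<alpha>\<close> on the time line.  Its value
at \<open>0\<close> is \<open>0\<close>.
\<close>
definition riesz_kernel :: "real \<Rightarrow> 'a::euclidean_space \<Rightarrow> real" where
  "riesz_kernel \<beta> z = 1 / norm z powr (real DIM('a) + \<beta>)"

lemma riesz_kernel_nonneg [simp]: "0 \<le> riesz_kernel \<beta> z"
  by (simp add: riesz_kernel_def)

lemma riesz_kernel_measurable [measurable]: "riesz_kernel \<beta> \<in> borel_measurable borel"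
  unfolding riesz_kernel_def [abs_def] by measurable

lemma riesz_kernel_uminus [simp]: "riesz_kernel \<beta> (- z) = riesz_kernel \<beta> z"
  by (simp add: riesz_kernel_def)

lemma riesz_kernel_antimono:
  fixes y z :: "'a::euclidean_space"
  assumes "y \<noteq> 0" "norm y \<le> norm z" "0 < \<beta>"
  shows "riesz_kernel \<beta> z \<le> riesz_kernel \<beta> y"
  unfolding riesz_kernel_def using assms
  by (intro divide_left_mono powr_mono2 mult_pos_pos) auto

text \<open>
Every point other than \<open>0\<close> lies in one dyadic shell inside or outside the sphere of radius \<open>r\<close>, and on
a shell the function is at most the corresponding coefficient.  Each shell is replaced by the ball
that it bounds, whose volume is explicit.
\<close>
lemma truncated_kernel_le_dyadic_sum:
  fixes z :: "'a::euclidean_space" and p :: nat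
  assumes "0 < r" "0 < \<beta>"
  shows "ennreal (min 1 ((norm z / r) ^ p) * riesz_kernel \<beta> z)
    \<le> (\<Sum>j. ennreal ((1 / 2 ^ j) ^ p * (r / 2 ^ Suc j) powr - (real DIM('a) + \<beta>)) * indicator (cball 0 (r / 2 ^ j)) z)
     + (\<Sum>j. ennreal ((r * 2 ^ j) powr - (real DIM('a) + \<beta>)) * indicator (cball 0 (r * 2 ^ Suc j)) z)"
    (is "?L \<le> (\<Sum>j. ?a j) + (\<Sum>j. ?b j)")
proof (cases "z = 0")
  case True
  then show ?thesis by (simp add: riesz_kernel_def)
next
  case False
  define N where "N = real DIM('a) + \<beta>"
  have N: "N > 0" using assms by (simp add: N_def add_nonneg_pos)
  have nz: "norm z > 0" using False by simp
  have K: "riesz_kernel \<beta> z = norm z powr - N" by (simp add: riesz_kernel_def flip: N_def powr_minus_divide)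
  have le_suminf: "f j \<le> (\<Sum>j. f j)" for f :: "nat \<Rightarrow> ennreal" and j
    using sum_le_suminf[of f "{j}"] by simp
  show ?thesis
  proof (cases "norm z \<le> r")
    case True
    obtain j where j: "r / 2 ^ Suc j < norm z" "norm z \<le> r / 2 ^ j"
    proof -
      obtain i where i: "(1/2 :: real) ^ i < norm z / r"
        using real_arch_pow_inv[of "norm z / r" "1/2"] nz assms by auto
      have ex: "\<exists>i. r / 2 ^ Suc i < norm z"
      proof (rule exI[of _ i])
        have "r / 2 ^ i < norm z" using i assms by (simp add: field_simps power_one_over)
        moreover have "r / 2 ^ Suc i \<le> r / 2 ^ i" using assms by (simp add: field_simps)
        ultimately show "r / 2 ^ Suc i < norm z" by simp
      qed
      define j where "j = (LEAST i. r / 2 ^ Suc i < norm z)"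
      have 1: "r / 2 ^ Suc j < norm z" unfolding j_def by (rule LeastI_ex[OF ex])
      have 2: "norm z \<le> r / 2 ^ j"
      proof (cases j)
        case 0
        then show ?thesis using True by simp
      next
        case (Suc i)
        then have "\<not> r / 2 ^ Suc i < norm z" unfolding j_def using not_less_Least by (metis lessI)
        then show ?thesis using Suc by simp
      qed
      show ?thesis using that 1 2 by blast
    qed
    have "min 1 ((norm z / r) ^ p) \<le> (norm z / r) ^ p" by simp
    also have "\<dots> \<le> (1 / 2 ^ j) ^ p"
      using j assms by (intro power_mono) (auto simp: field_simps)
    finally have 1: "min 1 ((norm z / r) ^ p) \<le> (1 / 2 ^ j) ^ p" .
    have 2: "norm z powr - N \<le> (r / 2 ^ Suc j) powr - N"
      using j assms N by (intro powr_mono2') auto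
    have "min 1 ((norm z / r) ^ p) * riesz_kernel \<beta> z \<le> (1 / 2 ^ j) ^ p * (r / 2 ^ Suc j) powr - N"
      unfolding K by (intro mult_mono 1 2) auto
    then have "?L \<le> ?a j"
      using j by (auto simp: N_def intro!: ennreal_leI)
    also have "\<dots> \<le> (\<Sum>j. ?a j)" by (rule le_suminf)
    finally show ?thesis by (simp add: add_increasing2)
  next
    case False
    obtain j where j: "r * 2 ^ j < norm z" "norm z \<le> r * 2 ^ Suc j"
    proof -
      obtain i where i: "norm z / r < (2 :: real) ^ i"
        using real_arch_pow[of 2 "norm z / r"] by auto
      have ex: "\<exists>i. norm z \<le> r * 2 ^ Suc i"
      proof (rule exI[of _ i])
        have "norm z < r * 2 ^ i" using i assms by (simp add: field_simps)
        moreover have "r * 2 ^ i \<le> r * 2 ^ Suc i" using assms by simp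
        ultimately show "norm z \<le> r * 2 ^ Suc i" by simp
      qed
      define j where "j = (LEAST i. norm z \<le> r * 2 ^ Suc i)"
      have 1: "norm z \<le> r * 2 ^ Suc j" unfolding j_def by (rule LeastI_ex[OF ex])
      have 2: "r * 2 ^ j < norm z"
      proof (cases j)
        case 0
        then show ?thesis using False by simp
      next
        case (Suc i)
        then have "\<not> norm z \<le> r * 2 ^ Suc i" unfolding j_def using not_less_Least by (metis lessI)
        then show ?thesis using Suc by simp
      qed
      show ?thesis using that 1 2 by blast
    qed
    have 2: "norm z powr - N \<le> (r * 2 ^ j) powr - N"
      using j assms N by (intro powr_mono2') auto
    have "min 1 ((norm z / r) ^ p) * riesz_kernel \<beta> z \<le> 1 * (r * 2 ^ j) powr - N"
      unfolding K by (intro mult_mono 2) auto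
    then have "?L \<le> ?b j"
      using j by (auto simp: N_def intro!: ennreal_leI)
    also have "\<dots> \<le> (\<Sum>j. ?b j)" by (rule le_suminf)
    finally show ?thesis by (simp add: add_increasing)
  qed
qed

text \<open>
The constant does not depend on \<open>r\<close>: the integral scales like \<open>r powr - \<beta>\<close>.  Integrated over the balls,
the two dyadic sums are geometric series with ratios \<open>2 powr (\<beta> - p)\<close> (towards the origin, convergent
as \<open>\<beta> < p\<close>) and \<open>2 powr - \<beta>\<close> (towards infinity, convergent as \<open>0 < \<beta>\<close>).  The case \<open>p = 2\<close> is for
second differences, \<open>p = 1\<close> for first-order increments in time.
\<close>
lemma truncated_kernel_integral:
  fixes p :: nat
  assumes \<beta>: "0 < \<beta>" "\<beta> < real p"
  obtains C where "C > 0"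
    and "\<And>r. r > 0 \<Longrightarrow> integrable lborel (\<lambda>z::'a::euclidean_space. min 1 ((norm z / r) ^ p) * riesz_kernel \<beta> z)"
    and "\<And>r. r > 0 \<Longrightarrow> (LINT z::'a|lborel. min 1 ((norm z / r) ^ p) * riesz_kernel \<beta> z) \<le> C * r powr - \<beta>"
proof -
  define n where "n = DIM('a)"
  define N where "N = real n + \<beta>"
  define V where "V = unit_ball_vol (real n)"
  have V: "V \<ge> 0" by (simp add: V_def unit_ball_vol_nonneg)
  define q where "q = 2 powr (\<beta> - real p)"
  define q' where "q' = 2 powr (- \<beta>)"
  have q: "0 \<le> q" "q < 1" "0 \<le> q'" "q' < 1"
    using \<beta> by (auto simp: q_def q'_def powr_less_one)
  define C where "C = V * 2 powr N * (1 / (1 - q)) + V * 2 ^ n * (1 / (1 - q')) + 1"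
  have C: "C > 0"
    unfolding C_def using V q by (intro add_nonneg_pos add_nonneg_nonneg mult_nonneg_nonneg) auto
  have bound: "(\<integral>\<^sup>+ (z::'a). ennreal (min 1 ((norm z / r) ^ p) * riesz_kernel \<beta> z) \<partial>lborel) \<le> ennreal (C * r powr - \<beta>)"
    if r: "r > 0" for r
  proof -
    define a where "a j = (1 / 2 ^ j) ^ p * (r / 2 ^ Suc j) powr - N" for j :: nat
    define b where "b j = (r * 2 ^ j) powr - N" for j :: nat
    have ab: "a j \<ge> 0" "b j \<ge> 0" for j by (auto simp: a_def b_def)
    have two: "(2::real) ^ j = 2 powr real j" for j by (simp add: powr_realpow)
    have rn: "r ^ n = r powr real n" using r by (simp add: powr_realpow)
    have a_eq: "a j * (V * (r / 2 ^ j) ^ n) = (V * 2 powr N * r powr - \<beta>) * q ^ j" for j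
    proof -
      have "q ^ j = 2 powr (real j * (\<beta> - real p))"
        by (simp add: q_def powr_power mult.commute)
      moreover have "a j = 2 powr (- (real j * real p)) * (r powr - N * 2 powr ((real j + 1) * N))"
      proof -
        have "(1 / 2 ^ j) ^ p = (2::real) powr (- (real j * real p))"
          by (simp add: power_one_over power_mult [symmetric] powr_minus_divide powr_powr flip: powr_realpow)
        moreover have "(r / 2 ^ Suc j) powr - N = r powr - N * 2 powr ((real j + 1) * N)"
        proof -
          have "(2::real) ^ Suc j = 2 powr (real j + 1)"
            using two[of "Suc j"] by (simp add: add.commute)
          then show ?thesis using r by (simp only:) (simp add: powr_divide powr_powr powr_minus_divide)
        qed
        ultimately show ?thesis by (simp add: a_def)
      qed
      moreover have "(r / 2 ^ j) ^ n = r powr real n * 2 powr (- (real j * real n))"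
        using r by (simp add: power_divide power_mult [symmetric] powr_minus_divide powr_powr flip: powr_realpow)
      ultimately have "a j * (V * (r / 2 ^ j) ^ n)
         = V * (r powr - N * r powr real n) * (2 powr (- (real j * real p)) * 2 powr ((real j + 1) * N) * 2 powr (- (real j * real n)))"
        by simp
      also have "r powr - N * r powr real n = r powr - \<beta>"
        by (simp add: powr_add [symmetric] N_def)
      also have "2 powr (- (real j * real p)) * 2 powr ((real j + 1) * N) * 2 powr (- (real j * real n))
         = 2 powr N * 2 powr (real j * (\<beta> - real p))"
        by (simp add: powr_add [symmetric] N_def algebra_simps)
      finally show ?thesis using \<open>q ^ j = _\<close> by (simp add: mult_ac)
    qed
    have b_eq: "b j * (V * (r * 2 ^ Suc j) ^ n) = (V * 2 ^ n * r powr - \<beta>) * q' ^ j" for j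
    proof -
      have "q' ^ j = 2 powr (- (real j * \<beta>))"
        by (simp add: q'_def powr_power mult.commute)
      moreover have "b j = r powr - N * 2 powr (- (real j * N))"
        using r by (simp add: b_def two powr_mult powr_powr)
      moreover have "(r * 2 ^ Suc j) ^ n = 2 ^ n * (r powr real n * 2 powr (real j * real n))"
        using r by (simp add: power_mult_distrib power_mult [symmetric] powr_powr flip: powr_realpow)
      ultimately have "b j * (V * (r * 2 ^ Suc j) ^ n)
         = V * 2 ^ n * (r powr - N * r powr real n) * (2 powr (- (real j * N)) * 2 powr (real j * real n))"
        by simp
      also have "r powr - N * r powr real n = r powr - \<beta>"
        by (simp add: powr_add [symmetric] N_def)
      also have "2 powr (- (real j * N)) * 2 powr (real j * real n) = 2 powr (- (real j * \<beta>))"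
        by (simp add: powr_add [symmetric] N_def algebra_simps)
      finally show ?thesis using \<open>q' ^ j = _\<close> by (simp add: mult_ac)
    qed
    have vol: "emeasure lborel (cball (0::'a) \<rho>) = ennreal (V * \<rho> ^ n)" if "\<rho> \<ge> 0" for \<rho>
      using emeasure_cball[OF that, of "0::'a"] by (simp add: V_def n_def)
    have shells_meas: "(\<lambda>z::'a. \<Sum>j. ennreal (c j) * indicator (cball 0 (\<rho> j)) z) \<in> borel_measurable lborel"
      for c \<rho> :: "nat \<Rightarrow> real"
      by (intro borel_measurable_suminf_order borel_measurable_times_ennreal borel_measurable_const borel_measurable_indicator) auto
    have shells: "(\<integral>\<^sup>+ (z::'a). (\<Sum>j. ennreal (c j) * indicator (cball 0 (\<rho> j)) z) \<partial>lborel)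
      = (\<Sum>j. ennreal (c j) * emeasure lborel (cball (0::'a) (\<rho> j)))" for c \<rho> :: "nat \<Rightarrow> real"
      by (subst nn_integral_suminf)
        (auto simp: nn_integral_cmult_indicator intro!: borel_measurable_times_ennreal borel_measurable_indicator)
    have "(\<integral>\<^sup>+ (z::'a). ennreal (min 1 ((norm z / r) ^ p) * riesz_kernel \<beta> z) \<partial>lborel)
      \<le> (\<integral>\<^sup>+ (z::'a). (\<Sum>j. ennreal (a j) * indicator (cball 0 (r / 2 ^ j)) z)
            + (\<Sum>j. ennreal (b j) * indicator (cball 0 (r * 2 ^ Suc j)) z) \<partial>lborel)"
      unfolding a_def b_def N_def n_def
      by (intro nn_integral_mono truncated_kernel_le_dyadic_sum r \<beta>)
    also have "\<dots> = (\<Sum>j. ennreal (a j) * emeasure lborel (cball (0::'a) (r / 2 ^ j)))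
            + (\<Sum>j. ennreal (b j) * emeasure lborel (cball (0::'a) (r * 2 ^ Suc j)))"
      by (subst nn_integral_add) (simp_all only: shells_meas shells)
    also have "\<dots> = (\<Sum>j. ennreal ((V * 2 powr N * r powr - \<beta>) * q ^ j)) + (\<Sum>j. ennreal ((V * 2 ^ n * r powr - \<beta>) * q' ^ j))"
      using r V ab by (simp only: vol ennreal_mult'[symmetric] flip: a_eq b_eq) (simp add: vol ennreal_mult)
    also have "\<dots> = ennreal ((V * 2 powr N * r powr - \<beta>) * (1 / (1 - q))) + ennreal ((V * 2 ^ n * r powr - \<beta>) * (1 / (1 - q')))"
    proof -
      have "(\<Sum>j. ennreal ((V * 2 powr N * r powr - \<beta>) * q ^ j)) = ennreal ((V * 2 powr N * r powr - \<beta>) * (1 / (1 - q)))"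
        using q V by (intro suminf_ennreal_eq sums_mult geometric_sums) auto
      moreover have "(\<Sum>j. ennreal ((V * 2 ^ n * r powr - \<beta>) * q' ^ j)) = ennreal ((V * 2 ^ n * r powr - \<beta>) * (1 / (1 - q')))"
        using q V by (intro suminf_ennreal_eq sums_mult geometric_sums) auto
      ultimately show ?thesis by simp
    qed
    also have "\<dots> = ennreal ((V * 2 powr N * r powr - \<beta>) * (1 / (1 - q)) + (V * 2 ^ n * r powr - \<beta>) * (1 / (1 - q')))"
      using q V by (intro ennreal_plus[symmetric]) auto
    also have "\<dots> \<le> ennreal (C * r powr - \<beta>)"
      unfolding C_def by (intro ennreal_leI) (simp add: algebra_simps)
    finally show ?thesis .
  qed
  show ?thesis
  proof (rule that[OF C])
    fix r :: real assume r: "r > 0"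
    have nn: "min 1 ((norm z / r) ^ p) * riesz_kernel \<beta> z \<ge> 0" for z :: 'a using r by simp
    show int: "integrable lborel (\<lambda>z::'a. min 1 ((norm z / r) ^ p) * riesz_kernel \<beta> z)"
      using bound[OF r] nn by (intro integrableI_nonneg) (auto intro: le_less_trans)
    have "ennreal (LINT z::'a|lborel. min 1 ((norm z / r) ^ p) * riesz_kernel \<beta> z) \<le> ennreal (C * r powr - \<beta>)"
      using bound[OF r] nn_integral_eq_integral[OF int] nn by simp
    then show "(LINT z::'a|lborel. min 1 ((norm z / r) ^ p) * riesz_kernel \<beta> z) \<le> C * r powr - \<beta>"
      using C by (subst (asm) ennreal_le_iff) auto
  qed
qed

lemma truncated_kernel_integrable:
  fixes p :: nat
  assumes "0 < \<beta>" "\<beta> < real p" "0 < r"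
  shows "integrable lborel (\<lambda>z::'a::euclidean_space. min 1 ((norm z / r) ^ p) * riesz_kernel \<beta> z)"
  by (rule truncated_kernel_integral[OF assms(1,2), where 'a = 'a]) (use assms(3) in auto)

section \<open>Second differences, reflections and the Lebesgue measure\<close>

text \<open>
The first-order term of the Taylor expansion cancels here, so that integrals against the Riesz kernel
of order below \<open>2\<close> converge absolutely and no principal value is left.
\<close>
definition second_diff :: "('a::real_vector \<Rightarrow> real) \<Rightarrow> 'a \<Rightarrow> 'a \<Rightarrow> real" where
  "second_diff v x z = 2 * v x - v (x + z) - v (x - z)"

lemma second_diff_measurable:
  fixes v :: "'a::euclidean_space \<Rightarrow> real"
  assumes "v \<in> borel_measurable borel"
  shows "second_diff v x \<in> borel_measurable borel"
  unfolding second_diff_def [abs_def] using assms by measurable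

lemma lborel_distr_sign_change:
  fixes c :: "'a::euclidean_space \<Rightarrow> real"
  assumes "\<And>j. j \<in> Basis \<Longrightarrow> \<bar>c j\<bar> = 1"
  shows "distr lborel borel (\<lambda>x. t + (\<Sum>j\<in>Basis. (c j * (x \<bullet> j)) *\<^sub>R j)) = lborel"
proof -
  have "c j \<noteq> 0" if "j \<in> Basis" for j using assms[OF that] by auto
  moreover have "(\<Prod>j\<in>Basis. \<bar>c j\<bar>) = 1" using assms by simp
  ultimately show ?thesis
    using lborel_affine_euclidean[of c t] by (simp add: density_1)
qed

lemma lborel_distr_uminus_euclidean: "distr lborel borel uminus = (lborel :: 'a::euclidean_space measure)"
proof -
  have eq: "uminus = (\<lambda>x::'a. 0 + (\<Sum>j\<in>Basis. (-1 * (x \<bullet> j)) *\<^sub>R j))"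
    by (simp add: fun_eq_iff sum_negf euclidean_representation)
  show ?thesis unfolding eq by (rule lborel_distr_sign_change) simp
qed

text \<open>
The reflection in the hyperplane \<open>x \<bullet> e = l\<close> for a unit vector \<open>e\<close>; the case \<open>l = 0\<close> is its linear part.
\<close>
definition reflect :: "'a::euclidean_space \<Rightarrow> real \<Rightarrow> 'a \<Rightarrow> 'a" where
  "reflect e l x = x + (2 * (l - x \<bullet> e)) *\<^sub>R e"

lemma reflect_inner: "e \<in> Basis \<Longrightarrow> reflect e l x \<bullet> e = 2 * l - x \<bullet> e"
  by (simp add: reflect_def inner_add_left)

lemma reflect_reflect [simp]: "e \<in> Basis \<Longrightarrow> reflect e l (reflect e l x) = x"
  unfolding reflect_def[of e l "reflect e l x"] reflect_inner by (simp add: reflect_def algebra_simps)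

lemma reflect_add: "reflect e l (x + z) = reflect e l x + reflect e 0 z"
  by (simp add: reflect_def inner_add_left algebra_simps)

lemma reflect_diff: "reflect e l (x - z) = reflect e l x - reflect e 0 z"
  by (simp add: reflect_def inner_diff_left algebra_simps)

lemma reflect_add_eq: "reflect e l (x + z) = x + reflect e (l - x \<bullet> e) z"
  by (simp add: reflect_def inner_add_left algebra_simps)

text \<open>
A point on the same side of the hyperplane as the origin is closer to the origin than its mirror image;
this formula gives the comparison of the kernel at the two points.
\<close>
lemma norm_reflect_sq:
  assumes e: "e \<in> Basis"
  shows "norm (reflect e d z) ^ 2 = norm z ^ 2 + 4 * d * (d - z \<bullet> e)"
proof -
  have "norm (z + c *\<^sub>R e) ^ 2 = norm z ^ 2 + 2 * c * (z \<bullet> e) + c ^ 2" for c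
    unfolding power2_norm_eq_inner using e
    by (simp add: inner_add_left inner_add_right inner_commute[of e z] power2_eq_square distrib_left)
  from this[of "2 * (d - z \<bullet> e)"] show ?thesis
    unfolding reflect_def by (simp only:) (simp add: power2_eq_square algebra_simps)
qed

lemma norm_reflect_0 [simp]: "e \<in> Basis \<Longrightarrow> norm (reflect e 0 z) = norm z"
  using norm_reflect_sq[of e 0 z] by (simp add: power2_eq_iff_nonneg)

lemma reflect_continuous [continuous_intros]: "continuous_on A (reflect e l)"
  unfolding reflect_def by (intro continuous_intros)

lemma reflect_measurable [measurable]: "reflect e l \<in> borel_measurable borel"
  by (intro borel_measurable_continuous_onI reflect_continuous)

lemma lborel_distr_reflect:
  assumes e: "e \<in> Basis"
  shows "distr lborel borel (reflect e l) = lborel"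
proof -
  define c where "c j = (if j = e then - 1 else 1 :: real)" for j
  have "reflect e l x = (2 * l) *\<^sub>R e + (\<Sum>j\<in>Basis. (c j * (x \<bullet> j)) *\<^sub>R j)" for x
  proof -
    have "(\<Sum>j\<in>Basis. (c j * (x \<bullet> j)) *\<^sub>R j) = (\<Sum>j\<in>Basis. (x \<bullet> j) *\<^sub>R j - (if j = e then (2 * (x \<bullet> j)) *\<^sub>R j else 0))"
      by (intro sum.cong) (auto simp: c_def simp flip: scaleR_left_diff_distrib)
    also have "\<dots> = x - (2 * (x \<bullet> e)) *\<^sub>R e"
      using e by (simp add: sum_subtractf euclidean_representation)
    finally show ?thesis by (simp add: reflect_def algebra_simps)
  qed
  then have "reflect e l = (\<lambda>x. (2 * l) *\<^sub>R e + (\<Sum>j\<in>Basis. (c j * (x \<bullet> j)) *\<^sub>R j))" by blast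
  then show ?thesis using lborel_distr_sign_change[of c "(2 * l) *\<^sub>R e"] by (simp add: c_def)
qed

lemma lborel_comp:
  fixes f :: "'a::euclidean_space \<Rightarrow> real"
  assumes T: "distr lborel borel T = (lborel :: 'a measure)" "T \<in> borel_measurable borel"
    and f: "f \<in> borel_measurable borel"
  shows "integrable lborel (\<lambda>x. f (T x)) \<longleftrightarrow> integrable lborel f"
    and "(LINT x|lborel. f (T x)) = (LINT x|lborel. f x)"
proof -
  have T': "T \<in> measurable lborel borel" using T(2) by simp
  show "integrable lborel (\<lambda>x. f (T x)) \<longleftrightarrow> integrable lborel f"
    using integrable_distr_eq[OF T', of f] f T(1) by simp
  show "(LINT x|lborel. f (T x)) = (LINT x|lborel. f x)"
    using integral_distr[OF T', of f] f T(1) by simp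
qed

lemma lborel_comp_uminus:
  fixes f :: "'a::euclidean_space \<Rightarrow> real"
  assumes "f \<in> borel_measurable borel"
  shows "integrable lborel (\<lambda>x. f (- x)) \<longleftrightarrow> integrable lborel f"
    and "(LINT x|lborel. f (- x)) = (LINT x|lborel. f x)"
  by (rule lborel_comp[OF lborel_distr_uminus_euclidean _ assms], simp)+

lemmas lborel_comp_reflect = lborel_comp[OF lborel_distr_reflect reflect_measurable]

lemma lborel_comp_translate:
  fixes f :: "'a::euclidean_space \<Rightarrow> real"
  assumes "f \<in> borel_measurable borel"
  shows "integrable lborel (\<lambda>x. f (a + x)) \<longleftrightarrow> integrable lborel f"
    and "(LINT x|lborel. f (a + x)) = (LINT x|lborel. f x)"
  by (rule lborel_comp[OF lborel_distr_plus _ assms], simp)+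

section \<open>The fractional Laplacian as an absolutely convergent integral\<close>

lemma C2_directional_derivative:
  fixes v :: "real^'n::finite \<Rightarrow> real"
  assumes "\<And>y. v differentiable (at y)"
  shows "((\<lambda>h. v (x + h *\<^sub>R z)) has_real_derivative (\<Sum>i\<in>UNIV. z $ i * partial_deriv i v (x + h *\<^sub>R z))) (at h)"
proof -
  define y where "y = x + h *\<^sub>R z"
  obtain D where D: "(v has_derivative D) (at y)" using assms[of y] by (auto simp: differentiable_def)
  then have lin: "linear D" by (rule has_derivative_linear)
  have dir: "((\<lambda>h. v (a + h *\<^sub>R b)) has_real_derivative D b) (at h)" if "a + h *\<^sub>R b = y" for a b h
  proof -
    have "((\<lambda>h. a + h *\<^sub>R b) has_derivative (\<lambda>h. h *\<^sub>R b)) (at h)"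
      by (auto intro!: derivative_eq_intros)
    from has_derivative_compose[OF this, of v D] D that
    have "((\<lambda>h. v (a + h *\<^sub>R b)) has_derivative (\<lambda>h. D (h *\<^sub>R b))) (at h)" by simp
    moreover have "(\<lambda>h. D (h *\<^sub>R b)) = (*) (D b)"
      by (simp add: fun_eq_iff linear_cmul[OF lin] mult.commute)
    ultimately show ?thesis unfolding has_field_derivative_def by simp
  qed
  have pd: "partial_deriv i v y = D (axis i 1)" for i
    unfolding partial_deriv_def by (rule DERIV_imp_deriv, rule dir) simp
  have "D z = D (\<Sum>i\<in>UNIV. z $ i *\<^sub>R axis i 1)" by (simp add: basis_expansion flip: scalar_mult_eq_scaleR)
  also have "\<dots> = (\<Sum>i\<in>UNIV. z $ i * partial_deriv i v y)"
    by (simp add: linear_sum[OF lin] linear_cmul[OF lin] pd)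
  finally show ?thesis using dir[of x h z] by (simp add: y_def)
qed

text \<open>
Along the segment from \<open>x - z\<close> to \<open>x + z\<close> the second derivative is a quadratic form in \<open>z\<close> whose
coefficients are second partial derivatives, bounded on the unit ball around \<open>x\<close> by continuity.
\<close>
lemma C2_second_diff_bound:
  fixes v :: "real^'n::finite \<Rightarrow> real"
  assumes v: "v \<in> C2_space"
  obtains B where "\<And>z. norm z \<le> 1 \<Longrightarrow> \<bar>second_diff v x z\<bar> \<le> B * norm z ^ 2"
proof -
  have d1: "\<And>y. v differentiable (at y)" and d2: "\<And>i y. partial_deriv i v differentiable (at y)"
    and c: "\<And>i j. continuous_on UNIV (partial_deriv i (partial_deriv j v))"
    using v by (auto simp: C2_space_def)
  have "\<exists>b. \<forall>y\<in>cball x 1. \<bar>partial_deriv i (partial_deriv j v) y\<bar> \<le> b" for i j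
  proof -
    have "compact (partial_deriv i (partial_deriv j v) ` cball x 1)"
      by (intro compact_continuous_image continuous_on_subset[OF c]) auto
    then show ?thesis using compact_imp_bounded by (fastforce simp: bounded_iff)
  qed
  then obtain b where b: "\<And>i j y. y \<in> cball x 1 \<Longrightarrow> \<bar>partial_deriv i (partial_deriv j v) y\<bar> \<le> b i j" by metis
  define B where "B = (\<Sum>i\<in>UNIV. \<Sum>j\<in>UNIV. b j i)"
  show ?thesis
  proof (rule that[of "2 * B"])
    fix z :: "real^'n" assume z: "norm z \<le> 1"
    define f' where "f' h = (\<Sum>i\<in>UNIV. z $ i * partial_deriv i v (x + h *\<^sub>R z))" for h
    define f'' where "f'' h = (\<Sum>i\<in>UNIV. z $ i * (\<Sum>j\<in>UNIV. z $ j * partial_deriv j (partial_deriv i v) (x + h *\<^sub>R z)))" for h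
    have D1: "((\<lambda>h. v (x + h *\<^sub>R z)) has_real_derivative f' h) (at h)" for h
      unfolding f'_def by (rule C2_directional_derivative[OF d1])
    have D2: "(f' has_real_derivative f'' h) (at h)" for h
      unfolding f'_def[abs_def] f''_def by (intro DERIV_sum DERIV_cmult C2_directional_derivative d2)
    have f''_bound: "\<bar>f'' h\<bar> \<le> B * norm z ^ 2" if h: "\<bar>h\<bar> \<le> 1" for h
    proof -
      have "x + h *\<^sub>R z \<in> cball x 1" using h z by (simp add: dist_norm mult_le_one)
      then have le: "\<bar>partial_deriv j (partial_deriv i v) (x + h *\<^sub>R z)\<bar> \<le> b j i" for i j by (rule b)
      have "\<bar>f'' h\<bar> \<le> (\<Sum>i\<in>UNIV. \<bar>z $ i\<bar> * (\<Sum>j\<in>UNIV. \<bar>z $ j\<bar> * \<bar>partial_deriv j (partial_deriv i v) (x + h *\<^sub>R z)\<bar>))"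
        unfolding f''_def
        by (intro sum_abs[THEN order_trans] sum_mono)
           (auto simp: abs_mult intro!: mult_left_mono order_trans[OF sum_abs] sum_mono)
      also have "\<dots> \<le> (\<Sum>i\<in>UNIV. norm z * (\<Sum>j\<in>UNIV. norm z * b j i))"
        by (intro sum_mono mult_mono component_le_norm_cart le sum_nonneg mult_nonneg_nonneg) auto
      also have "\<dots> = B * norm z ^ 2"
        by (simp add: B_def sum_distrib_left sum_distrib_right power2_eq_square mult_ac)
      finally show ?thesis .
    qed
    have lip: "\<bar>f' h - f' (- h)\<bar> \<le> 2 * (B * norm z ^ 2)" if h: "0 < h" "h < 1" for h
    proof -
      obtain \<xi> where \<xi>: "- h < \<xi>" "\<xi> < h" "f' h - f' (- h) = (h - - h) * f'' \<xi>"
        using MVT2[of "- h" h f' f''] D2 h by auto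
      have "\<bar>f' h - f' (- h)\<bar> = 2 * (h * \<bar>f'' \<xi>\<bar>)" using \<xi> h by (simp add: abs_mult)
      also have "\<dots> \<le> 2 * (1 * (B * norm z ^ 2))"
        using f''_bound[of \<xi>] \<xi> h by (intro mult_left_mono mult_mono) auto
      finally show ?thesis by simp
    qed
    define g where "g h = v (x + h *\<^sub>R z) + v (x + (- h) *\<^sub>R z)" for h
    have Dg: "(g has_real_derivative (f' h - f' (- h))) (at h)" for h
    proof -
      have "((\<lambda>h. v (x + (- h) *\<^sub>R z)) has_real_derivative (f' (- h) * - 1)) (at h)"
        by (rule DERIV_chain'[of uminus _ _ _ "\<lambda>h. v (x + h *\<^sub>R z)", OF _ D1]) (auto intro!: derivative_eq_intros)
      from DERIV_add[OF D1 this] show ?thesis unfolding g_def[abs_def] by simp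
    qed
    obtain \<xi> where \<xi>: "0 < \<xi>" "\<xi> < 1" "g 1 - g 0 = (1 - 0) * (f' \<xi> - f' (- \<xi>))"
      using MVT2[of 0 1 g "\<lambda>h. f' h - f' (- h)"] Dg by auto
    have "second_diff v x z = - (g 1 - g 0)" by (simp add: second_diff_def g_def)
    then show "\<bar>second_diff v x z\<bar> \<le> 2 * B * norm z ^ 2" using lip[of \<xi>] \<xi> by simp
  qed
qed

lemma C2_continuous: "v \<in> C2_space \<Longrightarrow> continuous_on UNIV v"
  by (auto simp: C2_space_def continuous_on_eq_continuous_at differentiable_imp_continuous_within)

lemma second_diff_kernel_integrable:
  fixes v :: "real^'n::finite \<Rightarrow> real"
  assumes v: "v \<in> C2_space" and M: "\<And>y. \<bar>v y\<bar> \<le> M" and s: "0 < s" "s < 1"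
  shows "integrable lborel (\<lambda>z. second_diff v x z * riesz_kernel (2 * s) z)"
proof -
  obtain B where B: "\<And>z. norm z \<le> 1 \<Longrightarrow> \<bar>second_diff v x z\<bar> \<le> B * norm z ^ 2"
    using C2_second_diff_bound[OF v] by metis
  have int: "integrable lborel (\<lambda>z::real^'n. max B (4 * M) * (min 1 (norm z ^ 2) * riesz_kernel (2 * s) z))"
    using truncated_kernel_integrable[of "2 * s" 2 1, where 'a = "real^'n"] s by simp
  have meas: "v \<in> borel_measurable borel" by (intro borel_measurable_continuous_onI C2_continuous v)
  have "norm (second_diff v x z * riesz_kernel (2 * s) z)
      \<le> norm (max B (4 * M) * (min 1 (norm z ^ 2) * riesz_kernel (2 * s) z))" for z
  proof -
    have M0: "M \<ge> 0" using M[of x] by linarith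
    have "\<bar>second_diff v x z\<bar> \<le> max B (4 * M) * min 1 (norm z ^ 2)"
    proof (cases "norm z \<le> 1")
      case True
      have "B * norm z ^ 2 \<le> max B (4 * M) * norm z ^ 2" by (intro mult_right_mono) auto
      then show ?thesis using B[OF True] True power_le_one[of "norm z" 2] by (simp add: min_absorb2)
    next
      case False
      then have "1 \<le> norm z ^ 2" by simp
      moreover have "\<bar>second_diff v x z\<bar> \<le> 4 * M"
        using M[of x] M[of "x + z"] M[of "x - z"] unfolding second_diff_def by linarith
      ultimately show ?thesis by (simp add: min_def)
    qed
    then have "\<bar>second_diff v x z\<bar> * riesz_kernel (2 * s) z \<le> (max B (4 * M) * min 1 (norm z ^ 2)) * riesz_kernel (2 * s) z"
      by (intro mult_right_mono) auto
    then show ?thesis using M0 by (simp add: abs_mult)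
  qed
  then show ?thesis
    using meas by (intro Bochner_Integration.integrable_bound[OF int])
      (auto intro!: borel_measurable_times second_diff_measurable)
qed

text \<open>
The removed ball is symmetric about \<open>x\<close>, so averaging the truncated integral over \<open>z\<close> and \<open>- z\<close> turns the
increments into second differences; dominated convergence then shows that the limit exists and
evaluates it.  All later estimates use this formula.
\<close>
lemma frac_laplacian_eq_second_diff:
  fixes v :: "real^'n::finite \<Rightarrow> real"
  assumes v: "v \<in> C2_space" and M: "\<And>y. \<bar>v y\<bar> \<le> M" and s: "0 < s" "s < 1"
  shows "frac_laplacian s v x
    = frac_laplacian_const CARD('n) s / 2 * (LINT z|lborel. second_diff v x z * riesz_kernel (2 * s) z)"
proof -
  let ?K = "riesz_kernel (2 * s) :: real^'n \<Rightarrow> real"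
  let ?D = "\<lambda>z. second_diff v x z * ?K z"
  have meas [measurable]: "v \<in> borel_measurable borel" by (intro borel_measurable_continuous_onI C2_continuous v)
  have measD [measurable]: "?D \<in> borel_measurable borel"
    by (intro borel_measurable_times second_diff_measurable meas riesz_kernel_measurable)
  have int: "integrable lborel ?D" by (rule second_diff_kernel_integrable[OF v M s])
  have ind [measurable]: "(indicator (- ball a \<epsilon>) :: real^'n \<Rightarrow> real) \<in> borel_measurable borel" for a \<epsilon>
    by (intro borel_measurable_indicator) auto
  have trunc: "(LINT y : (- ball x \<epsilon>) | lebesgue. (v x - v y) / norm (x - y) powr (real CARD('n) + 2 * s))
      = 1 / 2 * (LINT z|lborel. indicator (- ball 0 \<epsilon>) z * ?D z)" if \<epsilon>: "\<epsilon> > 0" for \<epsilon>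
  proof -
    define h where "h z = indicator (- ball 0 \<epsilon>) z * ((v x - v (x + z)) * ?K z)" for z
    have hmeas [measurable]: "h \<in> borel_measurable borel" unfolding h_def[abs_def] by measurable
    define F where "F y = indicator (- ball x \<epsilon>) y * ((v x - v y) / norm (x - y) powr (real CARD('n) + 2 * s))" for y
    have Fmeas [measurable]: "F \<in> borel_measurable borel" unfolding F_def[abs_def] by measurable
    have hF: "h z = F (x + z)" for z
      by (simp add: h_def F_def riesz_kernel_def indicator_def dist_norm)
    have kint: "integrable lborel (\<lambda>z::real^'n. min 1 ((norm z / \<epsilon>) ^ 2) * ?K z)"
      using s \<epsilon> by (intro truncated_kernel_integrable) auto
    have inth: "integrable lborel h"
    proof (rule Bochner_Integration.integrable_bound[OF integrable_mult_right[of "2 * M", OF kint]])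
      show "AE z in lborel. norm (h z) \<le> norm (2 * M * (min 1 ((norm z / \<epsilon>) ^ 2) * ?K z))"
      proof (rule AE_I2)
        fix z
        have M0: "M \<ge> 0" using M[of x] by linarith
        show "norm (h z) \<le> norm (2 * M * (min 1 ((norm z / \<epsilon>) ^ 2) * ?K z))"
        proof (cases "z \<in> ball 0 \<epsilon>")
          case True
          then show ?thesis by (simp add: h_def)
        next
          case False
          then have "1 \<le> norm z / \<epsilon>" using \<epsilon> by (simp add: field_simps)
          then have "min 1 ((norm z / \<epsilon>) ^ 2) = 1" by (simp add: one_le_power min_def)
          moreover have "\<bar>v x - v (x + z)\<bar> * ?K z \<le> 2 * M * ?K z"
            using M[of x] M[of "x + z"] by (intro mult_right_mono) auto
          ultimately show ?thesis using False M0 by (simp add: h_def abs_mult)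
        qed
      qed
    qed simp
    have "(LINT y : (- ball x \<epsilon>) | lebesgue. (v x - v y) / norm (x - y) powr (real CARD('n) + 2 * s)) = integral\<^sup>L lebesgue F"
      unfolding set_lebesgue_integral_def F_def[abs_def] by simp
    also have "\<dots> = integral\<^sup>L lborel F" by (rule integral_completion) simp
    also have "\<dots> = (LINT z|lborel. h z)" unfolding hF by (rule lborel_comp_translate(2)[symmetric]) simp
    also have "\<dots> = 1 / 2 * ((LINT z|lborel. h z) + (LINT z|lborel. h (- z)))"
      by (simp add: lborel_comp_uminus(2))
    also have "(LINT z|lborel. h z) + (LINT z|lborel. h (- z)) = (LINT z|lborel. h z + h (- z))"
      using inth by (subst Bochner_Integration.integral_add) (simp_all add: lborel_comp_uminus(1))
    also have "(\<lambda>z. h z + h (- z)) = (\<lambda>z. indicator (- ball 0 \<epsilon>) z * ?D z)"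
      by (auto simp: h_def second_diff_def indicator_def fun_eq_iff algebra_simps)
    finally show ?thesis .
  qed
  have lim: "((\<lambda>\<epsilon>. LINT z|lborel. indicator (- ball 0 \<epsilon>) z * ?D z) \<longlongrightarrow> (LINT z|lborel. ?D z)) (at_right 0)"
    unfolding filterlim_at_right_to_top
  proof (rule integral_dominated_convergence_at_top[where w = "\<lambda>z. norm (?D z)"])
    show "AE z in lborel. ((\<lambda>R. indicator (- ball 0 (inverse R)) z * ?D z) \<longlongrightarrow> ?D z) at_top"
    proof (rule AE_I2)
      fix z :: "real^'n"
      show "((\<lambda>R. indicator (- ball 0 (inverse R)) z * ?D z) \<longlongrightarrow> ?D z) at_top"
      proof (cases "z = 0")
        case True
        then show ?thesis by (simp add: second_diff_def)
      next
        case False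
        have "eventually (\<lambda>R. indicator (- ball 0 (inverse R)) z * ?D z = ?D z) at_top"
          using eventually_ge_at_top[of "1 / norm z"]
        proof eventually_elim
          case (elim R)
          moreover have "0 < R" using elim False by (meson less_le_trans zero_less_divide_1_iff zero_less_norm_iff)
          ultimately have "inverse R \<le> norm z" using False by (simp add: field_simps)
          then show ?case by simp
        qed
        then show ?thesis by (rule tendsto_eventually)
      qed
    qed
    show "eventually (\<lambda>R. AE z in lborel. norm (indicator (- ball 0 (inverse R)) z * ?D z) \<le> norm (?D z)) at_top"
      by (auto simp: indicator_def)
  qed (use int in \<open>auto intro!: borel_measurable_times simp: measD\<close>)
  have "((\<lambda>\<epsilon>. LINT y : (- ball x \<epsilon>) | lebesgue. (v x - v y) / norm (x - y) powr (real CARD('n) + 2 * s))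
      \<longlongrightarrow> 1 / 2 * (LINT z|lborel. ?D z)) (at_right 0)"
    by (rule Lim_transform_eventually[OF tendsto_mult_left[OF lim, of "1 / 2"]])
       (auto simp: trunc eventually_at_right_field intro!: exI[of _ 1])
  then show ?thesis
    unfolding frac_laplacian_def by (subst tendsto_Lim) auto
qed

text \<open>
The fractional Laplacian commutes with reflections, since the linear part preserves both the measure
and the kernel.  It therefore suffices to study second differences of the antisymmetric function \<open>w\<close>.
\<close>
lemma frac_laplacian_reflect_diff:
  fixes v :: "real^'n::finite \<Rightarrow> real" and l :: real
  assumes v: "v \<in> C2_space" and M: "\<And>y. \<bar>v y\<bar> \<le> M" and s: "0 < s" "s < 1" and e: "e \<in> Basis"
  defines "w \<equiv> (\<lambda>y. v (reflect e l y) - v y)"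
  shows "integrable lborel (\<lambda>z. second_diff w x z * riesz_kernel (2 * s) z)"
    and "frac_laplacian s v (reflect e l x) - frac_laplacian s v x
      = frac_laplacian_const CARD('n) s / 2 * (LINT z|lborel. second_diff w x z * riesz_kernel (2 * s) z)"
proof -
  let ?K = "riesz_kernel (2 * s) :: real^'n \<Rightarrow> real"
  let ?D = "\<lambda>x z. second_diff v x z * ?K z"
  have meas: "v \<in> borel_measurable borel" by (intro borel_measurable_continuous_onI C2_continuous v)
  have measD: "?D y \<in> borel_measurable borel" for y
    by (intro borel_measurable_times second_diff_measurable meas riesz_kernel_measurable)
  have int: "integrable lborel (?D y)" for y by (rule second_diff_kernel_integrable[OF v M s])
  have eq: "second_diff w x z * ?K z = ?D (reflect e l x) (reflect e 0 z) - ?D x z" for z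
  proof -
    have "second_diff w x z = second_diff v (reflect e l x) (reflect e 0 z) - second_diff v x z"
      by (simp add: second_diff_def w_def reflect_add reflect_diff algebra_simps)
    moreover have "?K (reflect e 0 z) = ?K z" by (simp add: riesz_kernel_def e)
    ultimately show ?thesis by (simp add: left_diff_distrib)
  qed
  have int': "integrable lborel (\<lambda>z. ?D (reflect e l x) (reflect e 0 z))"
    using int measD by (subst lborel_comp_reflect(1)[OF e]) auto
  show "integrable lborel (\<lambda>z. second_diff w x z * ?K z)"
    unfolding eq by (intro Bochner_Integration.integrable_diff int int')
  have "(LINT z|lborel. second_diff w x z * ?K z) = (LINT z|lborel. ?D (reflect e l x) z) - (LINT z|lborel. ?D x z)"
    unfolding eq using measD
    by (subst Bochner_Integration.integral_diff[OF int' int], subst lborel_comp_reflect(2)[OF e]) auto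
  then show "frac_laplacian s v (reflect e l x) - frac_laplacian s v x
      = frac_laplacian_const CARD('n) s / 2 * (LINT z|lborel. second_diff w x z * ?K z)"
    unfolding frac_laplacian_eq_second_diff[OF v M s] by (simp add: right_diff_distrib)
qed

section \<open>Nonlocal estimates at a touching point\<close>

text \<open>
The increment of a paraboloid centred at \<open>y\<close>, expanded around \<open>x\<close>.
\<close>
lemma sq_norm_shift_diff:
  "norm (x + z - y) ^ 2 - norm (x - y) ^ 2 = 2 * ((x - y) \<bullet> z) + norm z ^ 2"
proof -
  have "norm ((x - y) + z) ^ 2 = norm (x - y) ^ 2 + 2 * ((x - y) \<bullet> z) + norm z ^ 2"
    unfolding power2_norm_eq_inner inner_add_left inner_add_right by (simp add: inner_commute)
  then show ?thesis by (simp add: algebra_simps)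
qed

text \<open>
A paraboloid of height \<open>A\<close> and width \<open>r\<close> touches \<open>w\<close> from below at \<open>x\<close>.  In a symmetric difference its
linear part cancels, so the second difference is at most a multiple of \<open>A\<close> times the truncation.
\<close>
lemma touching_second_diff_bound:
  fixes \<beta> :: real
  assumes \<beta>: "0 < \<beta>" "\<beta> < 2"
  obtains C where "C > 0" and
    "\<And>(w :: 'a::euclidean_space \<Rightarrow> real) x x0 A r.
      \<lbrakk>integrable lborel (\<lambda>z. second_diff w x z * riesz_kernel \<beta> z); 0 < r; 0 \<le> A;
       \<And>y. w x - A \<le> w y;
       \<And>y. w x - A / r ^ 2 * (norm (y - x0) ^ 2 - norm (x - x0) ^ 2) \<le> w y\<rbrakk>
      \<Longrightarrow> (LINT z|lborel. second_diff w x z * riesz_kernel \<beta> z) \<le> C * A * r powr - \<beta>"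
proof -
  obtain C where C: "C > 0"
    and int: "\<And>r. r > 0 \<Longrightarrow> integrable lborel (\<lambda>z::'a. min 1 ((norm z / r) ^ 2) * riesz_kernel \<beta> z)"
    and le: "\<And>r. r > 0 \<Longrightarrow> (LINT z::'a|lborel. min 1 ((norm z / r) ^ 2) * riesz_kernel \<beta> z) \<le> C * r powr - \<beta>"
    by (rule truncated_kernel_integral[of \<beta> 2, where 'a = 'a]) (use \<beta> in \<open>simp, simp, blast\<close>)
  show ?thesis
  proof (rule that[of "2 * C"])
    show "2 * C > 0" using C by simp
    fix w :: "'a \<Rightarrow> real" and x x0 A r
    assume intD: "integrable lborel (\<lambda>z. second_diff w x z * riesz_kernel \<beta> z)" and r: "0 < r" and A: "0 \<le> A"
      and H1: "\<And>y. w x - A \<le> w y"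
      and H2: "\<And>y. w x - A / r ^ 2 * (norm (y - x0) ^ 2 - norm (x - x0) ^ 2) \<le> w y"
    have D: "second_diff w x z \<le> 2 * A * min 1 ((norm z / r) ^ 2)" for z
    proof -
      have "norm (x + z - x0) ^ 2 + norm (x - z - x0) ^ 2 = 2 * norm (x - x0) ^ 2 + 2 * norm z ^ 2"
        using sq_norm_shift_diff[of x z x0] sq_norm_shift_diff[of x "- z" x0] by simp
      then have "(norm (x + z - x0) ^ 2 - norm (x - x0) ^ 2) + (norm (x - z - x0) ^ 2 - norm (x - x0) ^ 2) = 2 * norm z ^ 2"
        by simp
      then have "A / r ^ 2 * (norm (x + z - x0) ^ 2 - norm (x - x0) ^ 2) + A / r ^ 2 * (norm (x - z - x0) ^ 2 - norm (x - x0) ^ 2)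
          = A / r ^ 2 * (2 * norm z ^ 2)"
        by (simp only: distrib_left [symmetric])
      then have "second_diff w x z \<le> A / r ^ 2 * (2 * norm z ^ 2)"
        using H2[of "x + z"] H2[of "x - z"] unfolding second_diff_def by linarith
      moreover have "second_diff w x z \<le> 2 * A"
        using H1[of "x + z"] H1[of "x - z"] by (simp add: second_diff_def)
      ultimately show ?thesis by (simp add: min_def power_divide mult_ac)
    qed
    have "(LINT z|lborel. second_diff w x z * riesz_kernel \<beta> z)
        \<le> (LINT z::'a|lborel. 2 * A * (min 1 ((norm z / r) ^ 2) * riesz_kernel \<beta> z))"
    proof (rule Bochner_Integration.integral_mono)
      show "integrable lborel (\<lambda>z. second_diff w x z * riesz_kernel \<beta> z)" by (rule intD)
      show "integrable lborel (\<lambda>z::'a. 2 * A * (min 1 ((norm z / r) ^ 2) * riesz_kernel \<beta> z))"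
        by (intro integrable_mult_right int r)
      show "second_diff w x z * riesz_kernel \<beta> z \<le> 2 * A * (min 1 ((norm z / r) ^ 2) * riesz_kernel \<beta> z)" for z
        using mult_right_mono[OF D[of z] riesz_kernel_nonneg[of \<beta> z]] by (simp add: mult_ac)
    qed
    also have "\<dots> = 2 * A * (LINT z::'a|lborel. min 1 ((norm z / r) ^ 2) * riesz_kernel \<beta> z)" by simp
    also have "\<dots> \<le> 2 * A * (C * r powr - \<beta>)" using A by (intro mult_left_mono le r) auto
    finally show "(LINT z|lborel. second_diff w x z * riesz_kernel \<beta> z) \<le> 2 * C * A * r powr - \<beta>"
      by (simp add: mult_ac)
  qed
qed

text \<open>
This is the estimate that drives the moving planes.  Touching from below on one side of the plane only
accounts for the term with \<open>C\<close>.  Antisymmetry provides the gain: if \<open>w\<close> exceeds its touching paraboloid by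
some \<open>E\<close> at a point on the left, then at the mirror image \<open>w\<close> exceeds \<open>w x\<close> by about \<open>- 2 w x - E\<close>.  The
mirror image is farther from \<open>x\<close>, so that the kernel is smaller there and the two occurrences of \<open>E\<close>
combine with the favourable sign, whereas \<open>- 2 w x\<close>, which is positive, remains.

In the proof \<open>q\<close> is the paraboloid inside the ball of radius \<open>r\<close> and the worst case \<open>- A\<close> outside, both
seen from \<open>x\<close>, and \<open>E\<close> is the deviation of \<open>w\<close> from it, which is nonnegative on the left of the plane.
As \<open>E\<close> vanishes to second order at \<open>x\<close>, its integral converges by itself and can be rearranged by
reflection.
\<close>
lemma antisymmetric_second_diff_bound:
  fixes \<beta> :: real
  assumes \<beta>: "0 < \<beta>" "\<beta> < 2"
  obtains c C where "c > 0" "C > 0" and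
    "\<And>(w :: 'a::euclidean_space \<Rightarrow> real) e l x x0 A m r M.
      \<lbrakk>e \<in> Basis; w \<in> borel_measurable borel; \<And>y. w (reflect e l y) = - w y; \<And>y. \<bar>w y\<bar> \<le> M;
       integrable lborel (\<lambda>z. second_diff w x z * riesz_kernel \<beta> z);
       0 < r; r \<le> l - x \<bullet> e; l - x \<bullet> e \<le> 3 * r; norm (x - x0) \<le> r; 0 \<le> A; 0 \<le> m;
       \<And>y. y \<bullet> e < l \<Longrightarrow> w x - A \<le> w y;
       \<And>y. y \<bullet> e < l \<Longrightarrow> w x - A / r ^ 2 * (norm (y - x0) ^ 2 - norm (x - x0) ^ 2) \<le> w y;
       2 * w x + A \<le> - m\<rbrakk>
      \<Longrightarrow> (LINT z|lborel. second_diff w x z * riesz_kernel \<beta> z) \<le> (C * A - c * m) * r powr - \<beta>"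
proof -
  let ?K = "riesz_kernel \<beta> :: 'a \<Rightarrow> real"
  let ?n = "real DIM('a)"
  obtain C where C: "C > 0"
    and int: "\<And>r. r > 0 \<Longrightarrow> integrable lborel (\<lambda>z. min 1 ((norm z / r) ^ 2) * ?K z)"
    and le: "\<And>r. r > 0 \<Longrightarrow> (LINT z|lborel. min 1 ((norm z / r) ^ 2) * ?K z) \<le> C * r powr - \<beta>"
    by (rule truncated_kernel_integral[of \<beta> 2, where 'a = 'a]) (use \<beta> in \<open>simp, simp, blast\<close>)
  define V where "V = unit_ball_vol ?n"
  have V: "V > 0" by (simp add: V_def)
  define c where "c = V / 7 powr (?n + \<beta>)"
  have c: "c > 0" using V by (simp add: c_def)
  show ?thesis
  proof (rule that[of c "2 * C"])
    show "c > 0" "2 * C > 0" using c C by auto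
    fix w :: "'a \<Rightarrow> real" and e l x x0 A m r M
    assume e: "e \<in> Basis" and meas [measurable]: "w \<in> borel_measurable borel"
      and anti: "\<And>y. w (reflect e l y) = - w y" and M: "\<And>y. \<bar>w y\<bar> \<le> M"
      and intD: "integrable lborel (\<lambda>z. second_diff w x z * ?K z)"
      and r: "0 < r" and rd: "r \<le> l - x \<bullet> e" and dr: "l - x \<bullet> e \<le> 3 * r" and xx0: "norm (x - x0) \<le> r"
      and A: "0 \<le> A" and m: "0 \<le> m"
      and H1: "\<And>y. y \<bullet> e < l \<Longrightarrow> w x - A \<le> w y"
      and H2: "\<And>y. y \<bullet> e < l \<Longrightarrow> w x - A / r ^ 2 * (norm (y - x0) ^ 2 - norm (x - x0) ^ 2) \<le> w y"
      and H3: "2 * w x + A \<le> - m"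
    define d where "d = l - x \<bullet> e"
    have d: "r \<le> d" "d \<le> 3 * r" using rd dr by (auto simp: d_def)
    define \<mu> where "\<mu> z = min 1 ((norm z / r) ^ 2)" for z :: 'a
    define q where "q z = (if norm z < r then - (A / r ^ 2) * (2 * ((x - x0) \<bullet> z) + norm z ^ 2) else - A)" for z
    have [measurable]: "q \<in> borel_measurable borel" unfolding q_def[abs_def] by measurable
    have ze: "\<bar>z \<bullet> e\<bar> \<le> norm z" for z :: 'a using Basis_le_norm[OF e] .
    have q_sym: "q z + q (- z) = - 2 * A * \<mu> z" for z
    proof (cases "norm z < r")
      case True
      then have "(norm z / r) ^ 2 \<le> 1" using r by (simp add: power_le_one)
      then show ?thesis using True r by (simp add: q_def \<mu>_def min_absorb2 power_divide field_simps)
    next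
      case False
      then have "1 \<le> (norm z / r) ^ 2" using r by (simp add: one_le_power)
      then show ?thesis using False by (simp add: q_def \<mu>_def min_absorb1)
    qed
    have q_le: "q z \<le> 2 * A" for z
    proof (cases "norm z < r")
      case True
      have "- ((x - x0) \<bullet> z) \<le> norm (x - x0) * norm z" using Cauchy_Schwarz_ineq2[of "x - x0" z] by linarith
      also have "\<dots> \<le> r * r" using True xx0 r by (intro mult_mono) auto
      finally have "- (2 * ((x - x0) \<bullet> z) + norm z ^ 2) \<le> 2 * r ^ 2"
        by (simp add: power2_eq_square) (smt (verit) zero_le_square)
      then have "(A / r ^ 2) * (- (2 * ((x - x0) \<bullet> z) + norm z ^ 2)) \<le> (A / r ^ 2) * (2 * r ^ 2)"
        using A by (intro mult_left_mono) auto
      moreover have "(A / r ^ 2) * (2 * r ^ 2) = 2 * A" using r by simp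
      moreover have "q z = (A / r ^ 2) * (- (2 * ((x - x0) \<bullet> z) + norm z ^ 2))"
        using True by (simp only: q_def if_True minus_mult_commute)
      ultimately show ?thesis by linarith
    qed (use A in \<open>simp add: q_def\<close>)
    define E where "E z = w (x + z) - w x - q z" for z
    have [measurable]: "E \<in> borel_measurable borel" unfolding E_def[abs_def] by measurable
    have E0: "E 0 = 0" using r by (simp add: E_def q_def)
    have E_nonneg: "0 \<le> E z" if z: "z \<bullet> e < d" for z
    proof -
      have S: "(x + z) \<bullet> e < l" using z by (simp add: d_def inner_add_left)
      have "norm (x + z - x0) ^ 2 - norm (x - x0) ^ 2 = 2 * ((x - x0) \<bullet> z) + norm z ^ 2"
        by (rule sq_norm_shift_diff)
      then show ?thesis using H1[OF S] H2[OF S] by (auto simp: E_def q_def)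
    qed
    have D_eq: "second_diff w x z = - (E z + E (- z)) + 2 * A * \<mu> z" for z
      using q_sym[of z] by (simp add: second_diff_def E_def)
    \<comment> \<open>In the ball both \<open>E z\<close> and \<open>E (- z)\<close> are nonnegative, so each is controlled by their sum.\<close>
    have E_le: "\<bar>E z\<bar> \<le> \<bar>second_diff w x z\<bar> + (2 * M + 3 * A) * \<mu> z" for z
    proof (cases "norm z < r")
      case True
      have "z \<bullet> e < d" "(- z) \<bullet> e < d" using ze[of z] True d by auto
      then have "0 \<le> E z" "0 \<le> E (- z)" by (auto intro: E_nonneg)
      then have "\<bar>E z\<bar> \<le> \<bar>second_diff w x z\<bar> + 2 * A * \<mu> z" using D_eq[of z] by linarith
      also have "2 * A * \<mu> z \<le> (2 * M + 3 * A) * \<mu> z"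
        using A M[of x] by (intro mult_right_mono) (auto simp: \<mu>_def)
      finally show ?thesis by simp
    next
      case False
      then have "1 \<le> (norm z / r) ^ 2" using r by (simp add: one_le_power)
      then have "\<mu> z = 1" by (simp add: \<mu>_def min_absorb1)
      moreover have "\<bar>E z\<bar> \<le> 2 * M + A"
        using False M[of x] M[of "x + z"] A by (simp add: E_def q_def)
      ultimately show ?thesis using A by simp
    qed
    have int\<mu>: "integrable lborel (\<lambda>z. \<mu> z * ?K z)" unfolding \<mu>_def by (rule int[OF r])
    have intE: "integrable lborel (\<lambda>z. E z * ?K z)"
    proof (rule Bochner_Integration.integrable_bound)
      show "integrable lborel (\<lambda>z. \<bar>second_diff w x z * ?K z\<bar> + (2 * M + 3 * A) * (\<mu> z * ?K z))"
        by (intro Bochner_Integration.integrable_add integrable_abs intD integrable_mult_right int\<mu>)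
      show "AE z in lborel. norm (E z * ?K z) \<le> norm (\<bar>second_diff w x z * ?K z\<bar> + (2 * M + 3 * A) * (\<mu> z * ?K z))"
      proof (rule AE_I2)
        fix z
        have "norm (E z * ?K z) \<le> \<bar>second_diff w x z * ?K z\<bar> + (2 * M + 3 * A) * (\<mu> z * ?K z)"
          using mult_right_mono[OF E_le[of z] riesz_kernel_nonneg[of \<beta> z]]
          by (simp add: abs_mult algebra_simps)
        then show "norm (E z * ?K z) \<le> norm (\<bar>second_diff w x z * ?K z\<bar> + (2 * M + 3 * A) * (\<mu> z * ?K z))" by simp
      qed
    qed simp
    \<comment> \<open>The integrand of \<open>E\<close> paired with its mirror image in the plane, which is at distance \<open>d\<close> from the origin.\<close>
    define I where "I z = E z * ?K z + E (reflect e d z) * ?K (reflect e d z)" for z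
    have E_reflect: "E (reflect e d z) \<ge> m - E z" if z: "z \<bullet> e \<le> d" for z
    proof -
      have "reflect e d z \<bullet> e \<ge> d" using z by (simp add: reflect_inner[OF e])
      then have "\<not> norm (reflect e d z) < r" using ze[of "reflect e d z"] d by linarith
      moreover have "x + reflect e d z = reflect e l (x + z)" by (simp add: reflect_add_eq d_def)
      ultimately have "E (reflect e d z) = - w (x + z) - w x + A" by (simp add: E_def q_def anti)
      then show ?thesis using q_le[of z] H3 by (simp add: E_def)
    qed
    have I_left: "I z \<ge> m * ?K (reflect e d z)" if z: "z \<bullet> e < d" for z
    proof -
      have "norm z ^ 2 \<le> norm (reflect e d z) ^ 2" using z d r by (simp add: norm_reflect_sq[OF e])
      then have nle: "norm z \<le> norm (reflect e d z)" by (simp add: power2_le_iff_abs_le)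
      have "0 \<le> E z * (?K z - ?K (reflect e d z))"
      proof (cases "z = 0")
        case False
        then show ?thesis using riesz_kernel_antimono[OF False nle] \<beta> E_nonneg[OF z] by simp
      qed (simp add: E0)
      moreover have "(m - E z) * ?K (reflect e d z) \<le> E (reflect e d z) * ?K (reflect e d z)"
        using E_reflect[of z] z by (intro mult_right_mono) auto
      ultimately show ?thesis by (simp add: I_def algebra_simps)
    qed
    have I_reflect: "I (reflect e d z) = I z" for z by (simp add: I_def e)
    \<comment> \<open>The gain is collected on one ball of radius \<open>r\<close> beyond the plane, at distance comparable to \<open>r\<close>.\<close>
    have I_ge: "m / (7 * r) powr (?n + \<beta>) * indicator (ball ((2 * d) *\<^sub>R e) r) z \<le> I z" for z
    proof -
      have "d < z \<bullet> e" and "norm z \<le> 7 * r" if "z \<in> ball ((2 * d) *\<^sub>R e) r"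
      proof -
        have zr: "norm ((2 * d) *\<^sub>R e - z) < r" using that by (simp add: dist_norm)
        show "d < z \<bullet> e" using ze[of "(2 * d) *\<^sub>R e - z"] zr d e by (simp add: inner_diff_left)
        have "norm z \<le> norm ((2 * d) *\<^sub>R e) + norm ((2 * d) *\<^sub>R e - z)"
          by (metis norm_triangle_sub norm_minus_commute)
        also have "norm ((2 * d) *\<^sub>R e) = 2 * d" using e d r by simp
        finally show "norm z \<le> 7 * r" using zr d by linarith
      qed
      note ball = this
      consider "z \<bullet> e < d" | "z \<bullet> e = d" | "z \<bullet> e > d" by linarith
      then show ?thesis
      proof cases
        case 1
        then have "z \<notin> ball ((2 * d) *\<^sub>R e) r" using ball(1) by fastforce
        then show ?thesis using order_trans[OF _ I_left[OF 1], of 0] m by simp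
      next
        case 2
        then have "z \<notin> ball ((2 * d) *\<^sub>R e) r" using ball(1) by fastforce
        moreover have "reflect e d z = z" using 2 by (simp add: reflect_def)
        moreover have "E z \<ge> 0" using E_reflect[of z] 2 m \<open>reflect e d z = z\<close> by simp
        ultimately show ?thesis by (simp add: I_def)
      next
        case 3
        then have "reflect e d z \<bullet> e < d" by (simp add: reflect_inner[OF e])
        from I_left[OF this] have ge: "m * ?K z \<le> I z" by (simp add: I_reflect e)
        show ?thesis
        proof (cases "z \<in> ball ((2 * d) *\<^sub>R e) r")
          case True
          have "norm z > 0" using 3 d r ze[of z] by linarith
          then have "1 / (7 * r) powr (?n + \<beta>) \<le> ?K z"
            unfolding riesz_kernel_def using ball(2)[OF True] \<beta> r
            by (intro divide_left_mono powr_mono2 mult_pos_pos) auto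
          from mult_left_mono[OF this m] ge True show ?thesis by simp
        next
          case False
          then show ?thesis using order_trans[OF _ ge, of 0] m by simp
        qed
      qed
    qed
    have intE': "integrable lborel (\<lambda>z. E (reflect e d z) * ?K (reflect e d z))"
      by (subst lborel_comp_reflect(1)[OF e, of "\<lambda>z. E z * ?K z"]) (use intE in auto)
    have "(LINT z|lborel. m / (7 * r) powr (?n + \<beta>) * indicator (ball ((2 * d) *\<^sub>R e) r) z) \<le> (LINT z|lborel. I z)"
    proof (rule Bochner_Integration.integral_mono)
      show "integrable lborel (\<lambda>z. m / (7 * r) powr (?n + \<beta>) * indicator (ball ((2 * d) *\<^sub>R e) r) z)"
        by (intro integrable_mult_right) (simp add: emeasure_ball r less_imp_le)
      show "integrable lborel I" unfolding I_def[abs_def] by (intro Bochner_Integration.integrable_add intE intE')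
    qed (rule I_ge)
    also have "(LINT z|lborel. I z) = (LINT z|lborel. E z * ?K z) + (LINT z|lborel. E (reflect e d z) * ?K (reflect e d z))"
      unfolding I_def by (rule Bochner_Integration.integral_add[OF intE intE'])
    also have "(LINT z|lborel. E (reflect e d z) * ?K (reflect e d z)) = (LINT z|lborel. E z * ?K z)"
      by (rule lborel_comp_reflect(2)[OF e, of "\<lambda>z. E z * ?K z"]) simp
    also have "(LINT z|lborel. m / (7 * r) powr (?n + \<beta>) * indicator (ball ((2 * d) *\<^sub>R e) r) z) = c * m * r powr - \<beta>"
    proof -
      have "measure lborel (ball ((2 * d) *\<^sub>R e) r) = V * r powr ?n"
        using r e by (simp add: content_ball V_def powr_realpow)
      moreover have "(7 * r) powr (?n + \<beta>) = 7 powr (?n + \<beta>) * (r powr ?n * r powr \<beta>)"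
        using r by (simp add: powr_mult powr_add)
      ultimately show ?thesis using r by (simp add: c_def powr_minus_divide)
    qed
    finally have lower: "c * m * r powr - \<beta> \<le> 2 * (LINT z|lborel. E z * ?K z)" by simp
    have intE'': "integrable lborel (\<lambda>z. E (- z) * ?K z)"
      using lborel_comp_uminus(1)[of "\<lambda>z. E z * ?K z"] intE by simp
    have "(LINT z|lborel. second_diff w x z * ?K z)
      = (LINT z|lborel. 2 * A * (\<mu> z * ?K z) - (E z * ?K z + E (- z) * ?K z))"
      by (intro Bochner_Integration.integral_cong) (auto simp: D_eq algebra_simps)
    also have "\<dots> = 2 * A * (LINT z|lborel. \<mu> z * ?K z) - ((LINT z|lborel. E z * ?K z) + (LINT z|lborel. E (- z) * ?K z))"
      using intE intE'' int\<mu> by simp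
    also have "(LINT z|lborel. E (- z) * ?K z) = (LINT z|lborel. E z * ?K z)"
      using lborel_comp_uminus(2)[of "\<lambda>z. E z * ?K z"] by simp
    also have "2 * A * (LINT z|lborel. \<mu> z * ?K z) \<le> 2 * A * (C * r powr - \<beta>)"
      unfolding \<mu>_def using A by (intro mult_left_mono le r) auto
    finally show "(LINT z|lborel. second_diff w x z * ?K z) \<le> (2 * C * A - c * m) * r powr - \<beta>"
      using lower by (simp add: algebra_simps)
  qed
qed

section \<open>The time derivative at a touching point\<close>

lemma C1_bounded_increment:
  fixes w :: "real \<Rightarrow> real"
  assumes w: "w C1_differentiable_on UNIV"
  obtains B where "\<And>\<tau>. \<bar>\<tau> - t\<bar> \<le> 1 \<Longrightarrow> \<bar>w t - w \<tau>\<bar> \<le> B * \<bar>\<tau> - t\<bar>"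
proof -
  obtain D where D: "\<And>x. (w has_real_derivative D x) (at x)" and cD: "continuous_on UNIV D"
    using w by (auto simp: C1_differentiable_on_def has_real_derivative_iff_has_vector_derivative)
  have "compact (D ` cball t 1)" by (intro compact_continuous_image continuous_on_subset[OF cD]) auto
  then obtain B where B: "\<And>x. x \<in> cball t 1 \<Longrightarrow> \<bar>D x\<bar> \<le> B"
    using compact_imp_bounded by (fastforce simp: bounded_iff)
  show ?thesis
  proof (rule that)
    fix \<tau> :: real assume "\<bar>\<tau> - t\<bar> \<le> 1"
    then have \<tau>: "\<tau> \<in> cball t 1" by (simp add: dist_real_def abs_minus_commute)
    have "norm (w t - w \<tau>) \<le> B * norm (t - \<tau>)"
      by (rule field_differentiable_bound[of "cball t 1" w D B])
         (use B D \<tau> in \<open>auto intro: has_field_derivative_at_within\<close>)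
    then show "\<bar>w t - w \<tau>\<bar> \<le> B * \<bar>\<tau> - t\<bar>" by (simp add: abs_minus_commute)
  qed
qed

text \<open>
Near \<open>t\<close> the increment is at most linear, as \<open>w\<close> is continuously differentiable, and far from \<open>t\<close> it is bounded.
\<close>
lemma marchaud_integrable:
  fixes w :: "real \<Rightarrow> real"
  assumes \<alpha>: "0 < \<alpha>" "\<alpha> < 1" and w: "w C1_differentiable_on UNIV" and M: "\<And>\<tau>. \<bar>w \<tau>\<bar> \<le> M"
  shows "set_integrable lebesgue {..<t} (\<lambda>\<tau>. (w t - w \<tau>) / (t - \<tau>) powr (1 + \<alpha>))"
proof -
  obtain B where B: "\<And>\<tau>. \<bar>\<tau> - t\<bar> \<le> 1 \<Longrightarrow> \<bar>w t - w \<tau>\<bar> \<le> B * \<bar>\<tau> - t\<bar>"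
    using C1_bounded_increment[OF w] by metis
  define N where "N = max B (2 * M)"
  define k where "k z = N * (min 1 ((norm z / 1) ^ 1) * riesz_kernel \<alpha> z)" for z :: real
  have intk: "integrable lborel k" unfolding k_def[abs_def]
    using \<alpha> by (intro integrable_mult_right truncated_kernel_integrable) auto
  have [measurable]: "k \<in> borel_measurable borel" using intk by auto
  have "integrable lborel (\<lambda>\<tau>. k (- t + \<tau>))"
    using intk by (subst lborel_comp_translate(1)) auto
  then have intk': "integrable lebesgue (\<lambda>\<tau>. k (- t + \<tau>))"
    by (subst integrable_completion) auto
  have cont: "continuous_on UNIV w"
    using C1_differentiable_imp_continuous_on[OF w] .
  have [measurable]: "w \<in> borel_measurable borel" by (intro borel_measurable_continuous_onI cont)
  have meas: "(\<lambda>\<tau>. indicat_real {..<t} \<tau> *\<^sub>R ((w t - w \<tau>) / (t - \<tau>) powr (1 + \<alpha>))) \<in> borel_measurable lebesgue"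
    by (intro measurable_completion) simp
  show ?thesis
    unfolding set_integrable_def
  proof (rule Bochner_Integration.integrable_bound[OF intk' meas], rule AE_I2)
    fix \<tau> :: real
    have M0: "M \<ge> 0" using M[of t] by linarith
    then have N0: "N \<ge> 0" by (simp add: N_def)
    have le: "\<bar>w t - w \<tau>\<bar> \<le> N * min 1 \<bar>\<tau> - t\<bar>"
    proof (cases "\<bar>\<tau> - t\<bar> \<le> 1")
      case True
      have "B * \<bar>\<tau> - t\<bar> \<le> N * \<bar>\<tau> - t\<bar>" by (intro mult_right_mono) (auto simp: N_def)
      then show ?thesis using B[OF True] True by (simp add: min_absorb2)
    next
      case False
      have "\<bar>w t - w \<tau>\<bar> \<le> N" using M[of t] M[of \<tau>] by (auto simp: N_def)
      then show ?thesis using False by (simp add: min_absorb1)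
    qed
    show "norm (indicat_real {..<t} \<tau> *\<^sub>R ((w t - w \<tau>) / (t - \<tau>) powr (1 + \<alpha>))) \<le> norm (k (- t + \<tau>))"
    proof (cases "\<tau> < t")
      case True
      have "\<bar>w t - w \<tau>\<bar> / (t - \<tau>) powr (1 + \<alpha>) \<le> N * min 1 \<bar>\<tau> - t\<bar> / (t - \<tau>) powr (1 + \<alpha>)"
        by (intro divide_right_mono le) auto
      also have "\<dots> = k (- t + \<tau>)"
        using True by (simp add: k_def riesz_kernel_def)
      finally show ?thesis using True by (simp add: abs_mult)
    qed simp
  qed
qed

text \<open>
Linearity has to be derived from the convergence of both integrals, as the Bochner integral of a
function that is not integrable is \<open>0\<close>.
\<close>
lemma frac_time_deriv_diff:
  fixes v w :: "real \<Rightarrow> real"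
  assumes \<alpha>: "0 < \<alpha>" "\<alpha> \<le> 1" and v: "v C1_differentiable_on UNIV" "\<And>\<tau>. \<bar>v \<tau>\<bar> \<le> M"
    and w: "w C1_differentiable_on UNIV" "\<And>\<tau>. \<bar>w \<tau>\<bar> \<le> M"
  shows "frac_time_deriv \<alpha> (\<lambda>\<tau>. v \<tau> - w \<tau>) t = frac_time_deriv \<alpha> v t - frac_time_deriv \<alpha> w t"
proof (cases "\<alpha> = 1")
  case True
  have diff: "v field_differentiable at t" "w field_differentiable at t"
    using v(1) w(1)
    by (auto simp: C1_differentiable_on_def field_differentiable_def has_real_derivative_iff_has_vector_derivative)
  then show ?thesis using True by (simp add: frac_time_deriv_def)
next
  case False
  then have \<alpha>: "0 < \<alpha>" "\<alpha> < 1" using \<alpha> by auto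
  have "(\<lambda>\<tau>. (v t - w t - (v \<tau> - w \<tau>)) / (t - \<tau>) powr (1 + \<alpha>))
     = (\<lambda>\<tau>. (v t - v \<tau>) / (t - \<tau>) powr (1 + \<alpha>) - (w t - w \<tau>) / (t - \<tau>) powr (1 + \<alpha>))"
    by (simp add: fun_eq_iff diff_divide_distrib)
  then show ?thesis
    using False set_integral_diff(2)[OF marchaud_integrable[OF \<alpha> v] marchaud_integrable[OF \<alpha> w]]
    by (simp add: frac_time_deriv_def marchaud_deriv_def right_diff_distrib)
qed

text \<open>
Only the past of \<open>t\<close> enters the Marchaud integral, and there the increment of \<open>w\<close> is dominated by that of the
touching parabola, of slope at most \<open>3 A / T\<close> for \<open>\<bar>\<tau> - t\<bar> \<le> T\<close>, and by \<open>A\<close> in any case.  For \<open>\<alpha> = 1\<close> the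
parabola is tangent at \<open>t\<close> and has slope at most \<open>2 A / T\<close> there.
\<close>
lemma touching_frac_time_deriv_bound:
  fixes \<alpha> :: real
  assumes \<alpha>: "0 < \<alpha>" "\<alpha> \<le> 1"
  obtains C where "C > 0" and
    "\<And>w t t0 A T.
      \<lbrakk>w differentiable (at t); 0 < T; 0 \<le> A; \<bar>t - t0\<bar> \<le> T;
       \<And>\<tau>. w t - A \<le> w \<tau>;
       \<And>\<tau>. w t - A / T ^ 2 * ((\<tau> - t0) ^ 2 - (t - t0) ^ 2) \<le> w \<tau>\<rbrakk>
      \<Longrightarrow> frac_time_deriv \<alpha> w t \<le> C * A * T powr - \<alpha>"
proof (cases "\<alpha> = 1")
  case True
  show ?thesis
  proof (rule that[of 2])
    fix w :: "real \<Rightarrow> real" and t t0 A T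
    assume w: "w differentiable (at t)" and T: "0 < T" and A: "0 \<le> A" and t: "\<bar>t - t0\<bar> \<le> T"
      and H2: "\<And>\<tau>. w t - A / T ^ 2 * ((\<tau> - t0) ^ 2 - (t - t0) ^ 2) \<le> w \<tau>"
    have D: "(w has_real_derivative deriv w t) (at t)"
      using w by (simp add: DERIV_deriv_iff_real_differentiable)
    have "((\<lambda>\<tau>. w \<tau> + A / T ^ 2 * (\<tau> - t0) ^ 2) has_real_derivative (deriv w t + A / T ^ 2 * (2 * (t - t0)))) (at t)"
      by (rule derivative_eq_intros D refl | simp)+
    moreover have "w t + A / T ^ 2 * (t - t0) ^ 2 \<le> w \<tau> + A / T ^ 2 * (\<tau> - t0) ^ 2" for \<tau>
      using H2[of \<tau>] by (simp add: right_diff_distrib)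
    ultimately have "deriv w t + A / T ^ 2 * (2 * (t - t0)) = 0"
      by (intro DERIV_local_min[of _ _ t 1]) auto
    then have "deriv w t = (A / T ^ 2) * (2 * (t0 - t))" by (simp add: algebra_simps)
    also have "\<dots> \<le> (A / T ^ 2) * (2 * T)" using t A by (intro mult_left_mono) auto
    also have "\<dots> = 2 * A * T powr - \<alpha>" using T True by (simp add: powr_minus power2_eq_square field_simps)
    finally show "frac_time_deriv \<alpha> w t \<le> 2 * A * T powr - \<alpha>" using True by (simp add: frac_time_deriv_def)
  qed simp
next
  case False
  then have \<alpha>: "0 < \<alpha>" "\<alpha> < 1" using \<alpha> by auto
  obtain C where C: "C > 0"
    and int: "\<And>r. r > 0 \<Longrightarrow> integrable lborel (\<lambda>z::real. min 1 ((norm z / r) ^ 1) * riesz_kernel \<alpha> z)"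
    and le: "\<And>r. r > 0 \<Longrightarrow> (LINT z::real|lborel. min 1 ((norm z / r) ^ 1) * riesz_kernel \<alpha> z) \<le> C * r powr - \<alpha>"
    by (rule truncated_kernel_integral[of \<alpha> 1, where 'a = real]) (use \<alpha> in \<open>simp, simp, blast\<close>)
  define G where "G = \<alpha> / Gamma (1 - \<alpha>)"
  have G: "G > 0" using \<alpha> by (simp add: G_def Gamma_real_pos)
  show ?thesis
  proof (rule that[of "G * (3 * C)"])
    show "G * (3 * C) > 0" using G C by simp
    fix w :: "real \<Rightarrow> real" and t t0 A T
    assume w: "w differentiable (at t)" and T: "0 < T" and A: "0 \<le> A" and t: "\<bar>t - t0\<bar> \<le> T"
      and H1: "\<And>\<tau>. w t - A \<le> w \<tau>"
      and H2: "\<And>\<tau>. w t - A / T ^ 2 * ((\<tau> - t0) ^ 2 - (t - t0) ^ 2) \<le> w \<tau>"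
    define k where "k z = 3 * A * (min 1 ((norm z / T) ^ 1) * riesz_kernel \<alpha> z)" for z :: real
    have intk: "integrable lborel k" unfolding k_def[abs_def] by (intro integrable_mult_right int T)
    have [measurable]: "k \<in> borel_measurable borel" using intk by auto
    have intk': "integrable lborel (\<lambda>\<tau>. k (- t + \<tau>))"
      using intk by (subst lborel_comp_translate(1)) auto
    have k0: "k z \<ge> 0" for z using A T by (simp add: k_def)
    have incr: "w t - w \<tau> \<le> 3 * A * min 1 (\<bar>\<tau> - t\<bar> / T)" for \<tau>
    proof (cases "\<bar>\<tau> - t\<bar> \<le> T")
      case True
      have "(\<tau> - t0) ^ 2 - (t - t0) ^ 2 = (\<tau> - t) * ((\<tau> - t) + 2 * (t - t0))"
        by (simp add: power2_eq_square algebra_simps)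
      also have "\<dots> \<le> \<bar>\<tau> - t\<bar> * \<bar>(\<tau> - t) + 2 * (t - t0)\<bar>" by (metis abs_ge_self abs_mult)
      also have "\<dots> \<le> \<bar>\<tau> - t\<bar> * (3 * T)" using True t by (intro mult_left_mono) auto
      finally have "A / T ^ 2 * ((\<tau> - t0) ^ 2 - (t - t0) ^ 2) \<le> A / T ^ 2 * (\<bar>\<tau> - t\<bar> * (3 * T))"
        using A by (intro mult_left_mono) auto
      also have "\<dots> = 3 * A * (\<bar>\<tau> - t\<bar> / T)" using T by (simp add: power2_eq_square)
      finally show ?thesis using H2[of \<tau>] True T by (simp add: min_absorb2)
    next
      case False
      then have "1 \<le> \<bar>\<tau> - t\<bar> / T" using T by simp
      then show ?thesis using H1[of \<tau>] A by (simp add: min_absorb1)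
    qed
    have "(LINT \<tau> : {..<t} | lebesgue. (w t - w \<tau>) / (t - \<tau>) powr (1 + \<alpha>)) \<le> (LINT \<tau>|lebesgue. k (- t + \<tau>))"
      unfolding set_lebesgue_integral_def
    proof (rule integral_mono')
      show "integrable lebesgue (\<lambda>\<tau>. k (- t + \<tau>))" using intk' by (subst integrable_completion) auto
      fix \<tau> :: real
      show "indicat_real {..<t} \<tau> *\<^sub>R ((w t - w \<tau>) / (t - \<tau>) powr (1 + \<alpha>)) \<le> k (- t + \<tau>)"
      proof (cases "\<tau> < t")
        case True
        have "(w t - w \<tau>) / (t - \<tau>) powr (1 + \<alpha>) \<le> 3 * A * min 1 (\<bar>\<tau> - t\<bar> / T) / (t - \<tau>) powr (1 + \<alpha>)"
          by (intro divide_right_mono incr) auto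
        also have "\<dots> = k (- t + \<tau>)" using True by (simp add: k_def riesz_kernel_def)
        finally show ?thesis using True by simp
      qed (simp add: k0)
    qed (rule k0)
    also have "\<dots> = (LINT \<tau>|lborel. k (- t + \<tau>))" by (rule integral_completion) simp
    also have "\<dots> = (LINT z|lborel. k z)" by (rule lborel_comp_translate(2)) simp
    also have "\<dots> = 3 * A * (LINT z::real|lborel. min 1 ((norm z / T) ^ 1) * riesz_kernel \<alpha> z)"
      unfolding k_def by (rule Bochner_Integration.integral_mult_right_zero)
    also have "\<dots> \<le> 3 * A * (C * T powr - \<alpha>)" using A by (intro mult_left_mono le T) auto
    finally have "G * (LINT \<tau> : {..<t} | lebesgue. (w t - w \<tau>) / (t - \<tau>) powr (1 + \<alpha>)) \<le> G * (3 * A * (C * T powr - \<alpha>))"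
      using G by (intro mult_left_mono) auto
    then show "frac_time_deriv \<alpha> w t \<le> G * (3 * C) * A * T powr - \<alpha>"
      using False by (simp add: frac_time_deriv_def marchaud_deriv_def G_def mult_ac)
  qed
qed

section \<open>The Laplacian at a touching point\<close>

text \<open>
Adding the touching parabola yields a function with a minimum at \<open>0\<close>; a negative second derivative there
would make it decrease to the right.
\<close>
lemma second_derivative_touching:
  fixes p :: "real \<Rightarrow> real"
  assumes p: "\<And>h. (p has_real_derivative p' h) (at h)" and p': "(p' has_real_derivative D) (at 0)"
    and ge: "\<And>h. \<bar>h\<bar> < \<epsilon> \<Longrightarrow> p 0 - a * h - b * h ^ 2 \<le> p h" and \<epsilon>: "\<epsilon> > 0"
  shows "- 2 * b \<le> D"
proof (rule ccontr)
  assume neg: "\<not> - 2 * b \<le> D"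
  define P where "P h = p h + a * h + b * h ^ 2" for h
  define P' where "P' h = p' h + a + 2 * b * h" for h
  have P: "(P has_real_derivative P' h) (at h)" for h
    unfolding P_def[abs_def] P'_def by (rule derivative_eq_intros p refl | simp)+
  have "(P' has_real_derivative (D + 2 * b)) (at 0)"
    unfolding P'_def[abs_def] by (rule derivative_eq_intros p' refl | simp)+
  from DERIV_neg_dec_right[OF this] neg obtain d where d: "d > 0" "\<And>h. 0 < h \<Longrightarrow> h < d \<Longrightarrow> P' h < P' 0"
    by auto
  have min: "P 0 \<le> P h" if "\<bar>h\<bar> < \<epsilon>" for h using ge[OF that] by (simp add: P_def)
  have "P' 0 = 0" by (rule DERIV_local_min[OF P \<epsilon>]) (use min in auto)
  define h where "h = min d \<epsilon> / 2"
  have h: "0 < h" "h < d" "h < \<epsilon>" using d \<epsilon> by (auto simp: h_def)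
  obtain \<xi> where \<xi>: "0 < \<xi>" "\<xi> < h" "P h - P 0 = (h - 0) * P' \<xi>"
    using MVT2[of 0 h P P'] P h by auto
  have "P' \<xi> < 0" using d(2)[of \<xi>] \<xi> h \<open>P' 0 = 0\<close> by simp
  then have "P h - P 0 < 0" using \<xi> h by (simp add: mult_pos_neg)
  then show False using min[of h] h by simp
qed

lemma axis_inner_eq: "axis i (1::real) \<bullet> axis j 1 = (if i = j then 1 else 0)"
  by (simp add: inner_axis_axis)

lemma partial_derivative_along_axis:
  fixes v :: "real^'n::finite \<Rightarrow> real"
  assumes "\<And>y. v differentiable (at y)"
  shows "((\<lambda>h. v (y + h *\<^sub>R (\<sigma> *\<^sub>R axis i 1))) has_real_derivative
    \<sigma> * partial_deriv i v (y + h *\<^sub>R (\<sigma> *\<^sub>R axis i 1))) (at h)"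
proof -
  have "(\<sigma> *\<^sub>R axis i 1 :: real^'n) $ j * f j = (if j = i then \<sigma> * f j else 0)" for f j
    by (simp add: axis_def)
  then have "(\<Sum>j\<in>UNIV. (\<sigma> *\<^sub>R axis i 1 :: real^'n) $ j * f j) = \<sigma> * f i" for f
    by simp
  then show ?thesis
    using C2_directional_derivative[OF assms, of y "\<sigma> *\<^sub>R axis i 1" h] by simp
qed

text \<open>
Restricted to a line in a coordinate direction, \<open>w\<close> is a difference of two restrictions of \<open>v\<close>.  The
reflection reverses the direction \<open>k\<close> and preserves the others; the sign \<open>\<sigma>\<close> disappears in the second
derivative.
\<close>
lemma laplacian_reflect_touching:
  fixes v :: "real^'n::finite \<Rightarrow> real" and l :: real
  assumes v: "v \<in> C2_space" and r: "r > 0" and xl: "x \<bullet> axis k 1 < l"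
  defines "w \<equiv> (\<lambda>y. v (reflect (axis k 1) l y) - v y)"
  assumes H2: "\<And>y. y \<bullet> axis k 1 < l \<Longrightarrow> w x - A / r ^ 2 * (norm (y - x0) ^ 2 - norm (x - x0) ^ 2) \<le> w y"
  shows "- 2 * real CARD('n) * A / r ^ 2 \<le> laplacian v (reflect (axis k 1) l x) - laplacian v x"
proof -
  define e :: "real^'n" where "e = axis k 1"
  define x' where "x' = reflect e l x"
  have d1: "\<And>y. v differentiable (at y)" and d2: "\<And>i y. partial_deriv i v differentiable (at y)"
    using v by (auto simp: C2_space_def)
  have "- 2 * (A / r ^ 2) \<le> partial_deriv i (partial_deriv i v) x' - partial_deriv i (partial_deriv i v) x" for i
  proof -
    define \<sigma> where "\<sigma> = (if i = k then - 1 else 1 :: real)"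
    have \<sigma>: "\<sigma> * (\<sigma> * a) = a" for a by (simp add: \<sigma>_def)
    define p where "p h = v (x' + h *\<^sub>R (\<sigma> *\<^sub>R axis i 1)) - v (x + h *\<^sub>R (1 *\<^sub>R axis i 1))" for h
    define p' where "p' h = \<sigma> * partial_deriv i v (x' + h *\<^sub>R (\<sigma> *\<^sub>R axis i 1)) - 1 * partial_deriv i v (x + h *\<^sub>R (1 *\<^sub>R axis i 1))" for h
    have Dp: "(p has_real_derivative p' h) (at h)" for h
      unfolding p_def[abs_def] p'_def by (intro DERIV_diff partial_derivative_along_axis d1)
    have Dp': "(p' has_real_derivative (\<sigma> * (\<sigma> * partial_deriv i (partial_deriv i v) (x' + 0 *\<^sub>R (\<sigma> *\<^sub>R axis i 1)))
        - 1 * (1 * partial_deriv i (partial_deriv i v) (x + 0 *\<^sub>R (1 *\<^sub>R axis i 1))))) (at 0)"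
      unfolding p'_def[abs_def] by (intro DERIV_diff DERIV_cmult partial_derivative_along_axis d2)
    have pw: "p h = w (x + h *\<^sub>R axis i 1)" for h
    proof -
      have "reflect e 0 (h *\<^sub>R axis i 1) = h *\<^sub>R (\<sigma> *\<^sub>R axis i 1)"
        by (auto simp: reflect_def e_def \<sigma>_def axis_inner_eq algebra_simps simp flip: scaleR_left_distrib)
      then show ?thesis by (simp add: p_def w_def x'_def reflect_add e_def[symmetric])
    qed
    define \<epsilon> where "\<epsilon> = l - x \<bullet> e"
    have \<epsilon>: "\<epsilon> > 0" using xl by (simp add: \<epsilon>_def e_def)
    have "p 0 - (A / r ^ 2 * (2 * ((x - x0) \<bullet> axis i 1))) * h - (A / r ^ 2) * h ^ 2 \<le> p h" if h: "\<bar>h\<bar> < \<epsilon>" for h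
    proof -
      have "(x + h *\<^sub>R axis i 1) \<bullet> axis k 1 < l"
        using h \<epsilon> by (auto simp: inner_add_left axis_inner_eq \<epsilon>_def e_def)
      from H2[OF this] have "w x - A / r ^ 2 * (2 * ((x - x0) \<bullet> (h *\<^sub>R axis i 1)) + norm (h *\<^sub>R axis i 1 :: real^'n) ^ 2) \<le> p h"
        unfolding sq_norm_shift_diff pw .
      moreover have "A / r ^ 2 * (2 * ((x - x0) \<bullet> (h *\<^sub>R axis i 1)) + norm (h *\<^sub>R axis i 1 :: real^'n) ^ 2)
          = (A / r ^ 2 * (2 * ((x - x0) \<bullet> axis i 1))) * h + (A / r ^ 2) * h ^ 2"
        by (simp add: distrib_left)
      moreover have "p 0 = w x" by (simp add: pw)
      ultimately show ?thesis by linarith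
    qed
    from second_derivative_touching[OF Dp Dp' this \<epsilon>] show ?thesis by (simp add: \<sigma>)
  qed
  then have "(\<Sum>i\<in>(UNIV :: 'n set). - 2 * (A / r ^ 2))
    \<le> (\<Sum>i\<in>UNIV. partial_deriv i (partial_deriv i v) x' - partial_deriv i (partial_deriv i v) x)"
    by (intro sum_mono) auto
  then show ?thesis by (simp add: laplacian_def sum_subtractf x'_def e_def mult_ac)
qed

lemma laplacian_touching:
  fixes v :: "real^'n::finite \<Rightarrow> real"
  assumes v: "v \<in> C2_space"
    and H2: "\<And>y. v x - A / r ^ 2 * (norm (y - x0) ^ 2 - norm (x - x0) ^ 2) \<le> v y"
  shows "- 2 * real CARD('n) * A / r ^ 2 \<le> laplacian v x"
proof -
  have d1: "\<And>y. v differentiable (at y)" and d2: "\<And>i y. partial_deriv i v differentiable (at y)"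
    using v by (auto simp: C2_space_def)
  have dir: "((\<lambda>h. u (y + h *\<^sub>R axis i 1)) has_real_derivative partial_deriv i u (y + h *\<^sub>R axis i 1)) (at h)"
    if "\<And>y. u differentiable (at y)" for u :: "real^'n \<Rightarrow> real" and y i h
    using partial_derivative_along_axis[OF that, of y 1 i h] by simp
  have "- 2 * (A / r ^ 2) \<le> partial_deriv i (partial_deriv i v) x" for i
  proof -
    have "v (x + 0 *\<^sub>R axis i 1) - (A / r ^ 2 * (2 * ((x - x0) \<bullet> axis i 1))) * h - (A / r ^ 2) * h ^ 2 \<le> v (x + h *\<^sub>R axis i 1)" for h
    proof -
      have "v x - A / r ^ 2 * (2 * ((x - x0) \<bullet> (h *\<^sub>R axis i 1)) + norm (h *\<^sub>R axis i 1 :: real^'n) ^ 2) \<le> v (x + h *\<^sub>R axis i 1)"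
        using H2[of "x + h *\<^sub>R axis i 1"] unfolding sq_norm_shift_diff .
      moreover have "A / r ^ 2 * (2 * ((x - x0) \<bullet> (h *\<^sub>R axis i 1)) + norm (h *\<^sub>R axis i 1 :: real^'n) ^ 2)
          = (A / r ^ 2 * (2 * ((x - x0) \<bullet> axis i 1))) * h + (A / r ^ 2) * h ^ 2"
        by (simp add: distrib_left)
      ultimately show ?thesis by simp
    qed
    from second_derivative_touching[OF dir[OF d1] dir[OF d2] this zero_less_one] show ?thesis by simp
  qed
  then have "(\<Sum>i\<in>(UNIV :: 'n set). - 2 * (A / r ^ 2)) \<le> (\<Sum>i\<in>UNIV. partial_deriv i (partial_deriv i v) x)"
    by (intro sum_mono) auto
  then show ?thesis by (simp add: laplacian_def mult_ac)
qed

section \<open>A minimum principle for reflected differences\<close>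

text \<open>
A function need not attain its infimum over an unbounded set, but a paraboloid of height \<open>A\<close> centred at a
point where the function is within \<open>A\<close> of a lower bound can be raised until it touches.  The minimum of \<open>w\<close> minus
the positive part of the paraboloid is taken over the compact cylinder: outside of it, \<open>w\<close> exceeds the
value that is already reached at the centre.  The positive part yields the lower
bound \<open>w x t - A\<close> on the whole of \<open>\<Omega>\<close>, and its kink does no harm because a paraboloid lies below its positive part.
\<close>
lemma touching_point:
  fixes w :: "'a::euclidean_space \<Rightarrow> real \<Rightarrow> real"
  assumes cont: "continuous_on (cball x0 r \<times> cball t0 T) (\<lambda>(x, t). w x t)" and r: "r > 0" and T: "T > 0"
    and sub: "cball x0 r \<subseteq> \<Omega>" and A: "0 \<le> A"
    and lower: "\<And>x t. x \<in> \<Omega> \<Longrightarrow> - m \<le> w x t" and start: "w x0 t0 < A - m"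
  obtains x t where "norm (x - x0) \<le> r" "\<bar>t - t0\<bar> \<le> T" "w x t \<le> w x0 t0"
    and "\<And>y \<tau>. y \<in> \<Omega> \<Longrightarrow> w x t - A \<le> w y \<tau>"
    and "\<And>y. y \<in> \<Omega> \<Longrightarrow> w x t - A / r ^ 2 * (norm (y - x0) ^ 2 - norm (x - x0) ^ 2) \<le> w y t"
    and "\<And>\<tau>. w x t - A / T ^ 2 * ((\<tau> - t0) ^ 2 - (t - t0) ^ 2) \<le> w x \<tau>"
proof -
  define Q where "Q y \<tau> = A - A / r ^ 2 * norm (y - x0) ^ 2 - A / T ^ 2 * (\<tau> - t0) ^ 2" for y \<tau>
  let ?S = "cball x0 r \<times> cball t0 T"
  have "continuous_on ?S (\<lambda>p. (\<lambda>(x, t). w x t) p - Q (fst p) (snd p))"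
    unfolding Q_def by (intro continuous_intros cont)
  then have "continuous_on ?S (\<lambda>p. w (fst p) (snd p) - Q (fst p) (snd p))" by (simp add: case_prod_beta)
  moreover have "compact ?S" "?S \<noteq> {}" using r T by (auto intro: compact_Times)
  ultimately obtain p where p: "p \<in> ?S"
    and pmin: "\<And>p'. p' \<in> ?S \<Longrightarrow> w (fst p) (snd p) - Q (fst p) (snd p) \<le> w (fst p') (snd p') - Q (fst p') (snd p')"
    using continuous_attains_inf[of ?S "\<lambda>p. w (fst p) (snd p) - Q (fst p) (snd p)"] by blast
  obtain x t where xt: "p = (x, t)" by (cases p)
  have x: "norm (x - x0) \<le> r" and t: "\<bar>t - t0\<bar> \<le> T"
    using p by (auto simp: xt dist_norm dist_real_def norm_minus_commute abs_minus_commute)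
  have inside: "w x t - Q x t \<le> w y \<tau> - Q y \<tau>" if "norm (y - x0) \<le> r" "\<bar>\<tau> - t0\<bar> \<le> T" for y \<tau>
    using pmin[of "(y, \<tau>)"] that by (simp add: xt dist_norm dist_real_def norm_minus_commute abs_minus_commute)
  have Q0: "Q x0 t0 = A" by (simp add: Q_def)
  have V: "w x t - Q x t \<le> w x0 t0 - A" using inside[of x0 t0] r T by (simp add: Q0)
  have "0 \<le> A / r ^ 2 * norm (x - x0) ^ 2" "0 \<le> A / T ^ 2 * (t - t0) ^ 2" using A by auto
  then have QA: "Q x t \<le> A" unfolding Q_def by linarith
  have nonneg: "w x t - Q x t \<le> w y \<tau>" if "y \<in> \<Omega>" for y \<tau>
    using lower[OF that, of \<tau>] V start by linarith
  have all: "w x t - Q x t \<le> w y \<tau> - Q y \<tau>" if y: "y \<in> \<Omega>" for y \<tau>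
  proof (cases "norm (y - x0) \<le> r \<and> \<bar>\<tau> - t0\<bar> \<le> T")
    case True
    then show ?thesis using inside by blast
  next
    case False
    have "A \<le> A / r ^ 2 * norm (y - x0) ^ 2 + A / T ^ 2 * (\<tau> - t0) ^ 2"
    proof (cases "norm (y - x0) \<le> r")
      case True
      then have "T ^ 2 \<le> \<bar>\<tau> - t0\<bar> ^ 2" using False T by (intro power_mono) auto
      then have "A / T ^ 2 * T ^ 2 \<le> A / T ^ 2 * (\<tau> - t0) ^ 2" using A by (intro mult_left_mono) auto
      then show ?thesis using T A by (simp add: add_increasing)
    next
      case False
      then have "r ^ 2 \<le> norm (y - x0) ^ 2" using r by (intro power_mono) auto
      then have "A / r ^ 2 * r ^ 2 \<le> A / r ^ 2 * norm (y - x0) ^ 2" using A by (intro mult_left_mono) auto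
      then show ?thesis using r A by (simp add: add_increasing2)
    qed
    then show ?thesis using nonneg[OF y, of \<tau>] by (simp add: Q_def)
  qed
  have x\<Omega>: "x \<in> \<Omega>" using x sub by (auto simp: dist_norm norm_minus_commute)
  show ?thesis
  proof (rule that[OF x t])
    show "w x t \<le> w x0 t0" using V QA by linarith
    show "w x t - A \<le> w y \<tau>" if "y \<in> \<Omega>" for y \<tau> using nonneg[OF that, of \<tau>] QA by linarith
    show "w x t - A / r ^ 2 * (norm (y - x0) ^ 2 - norm (x - x0) ^ 2) \<le> w y t" if "y \<in> \<Omega>" for y
      using all[OF that, of t] by (simp add: Q_def right_diff_distrib)
    show "w x t - A / T ^ 2 * ((\<tau> - t0) ^ 2 - (t - t0) ^ 2) \<le> w x \<tau>" for \<tau>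
      using all[OF x\<Omega>, of \<tau>] by (simp add: Q_def right_diff_distrib)
  qed
qed

definition master_operator :: "real \<Rightarrow> real \<Rightarrow> (real^'n::finite \<Rightarrow> real \<Rightarrow> real) \<Rightarrow> real^'n \<Rightarrow> real \<Rightarrow> real" where
  "master_operator s \<alpha> u x t =
     frac_time_deriv \<alpha> (u x) t + frac_laplacian s (\<lambda>y. u y t) x - laplacian (\<lambda>y. u y t) x"

text \<open>
The regularity that is needed to evaluate the operator, without the equation and without a sign.
\<close>
locale regular_bounded_function =
  fixes s \<alpha> M :: real and u :: "real^'n::finite \<Rightarrow> real \<Rightarrow> real"
  assumes s: "0 < s" "s < 1" and \<alpha>: "0 < \<alpha>" "\<alpha> \<le> 1"
    and C2: "\<And>t. (\<lambda>x. u x t) \<in> C2_space"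
    and C1: "\<And>x. u x C1_differentiable_on UNIV"
    and bound: "\<And>x t. \<bar>u x t\<bar> \<le> M"
    and unif: "uniformly_continuous_on UNIV (\<lambda>(x, t). u x t)"
begin

lemma unif_cont:
  assumes "\<epsilon> > 0"
  obtains \<delta> where "\<delta> > 0" "\<And>x y t. dist x y < \<delta> \<Longrightarrow> \<bar>u x t - u y t\<bar> < \<epsilon>"
proof -
  obtain \<delta> where \<delta>: "\<delta> > 0" and d: "\<And>p q. dist p q < \<delta> \<Longrightarrow> dist ((\<lambda>(x, t). u x t) p) ((\<lambda>(x, t). u x t) q) < \<epsilon>"
    using unif assms unfolding uniformly_continuous_on_def by (metis UNIV_I dist_commute)
  show ?thesis
  proof (rule that[OF \<delta>])
    fix x y :: "real^'n" and t :: real assume "dist x y < \<delta>"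
    then have "dist (x, t) (y, t) < \<delta>" by (simp add: dist_Pair_Pair)
    from d[OF this] show "\<bar>u x t - u y t\<bar> < \<epsilon>" by (simp add: dist_real_def)
  qed
qed

lemma continuous_u: "continuous_on S (\<lambda>(x, t). u x t)"
  using uniformly_continuous_imp_continuous[OF unif] continuous_on_subset by blast

lemma const_pos: "frac_laplacian_const CARD('n) s > 0"
  using s by (simp add: frac_laplacian_const_def Gamma_real_pos)

text \<open>
Used far to the right: where the operator is bounded by a constant that depends only on the size of the
function, the right-hand side of the equation cannot be large.
\<close>
lemma master_operator_touching_bound:
  obtains C where "C > 0" and
    "\<And>x0 t0 A. \<lbrakk>\<And>x t. 0 \<le> u x t; 0 \<le> A; u x0 t0 < A\<rbrakk>
      \<Longrightarrow> \<exists>x t. norm (x - x0) \<le> 1 \<and> \<bar>t - t0\<bar> \<le> 1 \<and> master_operator s \<alpha> u x t \<le> C * A"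
proof -
  let ?n = "real CARD('n)"
  define B where "B = frac_laplacian_const CARD('n) s / 2"
  have B: "B > 0" using const_pos by (simp add: B_def)
  have s2: "0 < 2 * s" "2 * s < 2" using s by auto
  obtain C1 where C1': "C1 > 0" and frac:
    "\<And>(w :: real^'n \<Rightarrow> real) x x0 A r.
      \<lbrakk>integrable lborel (\<lambda>z. second_diff w x z * riesz_kernel (2 * s) z); 0 < r; 0 \<le> A;
       \<And>y. w x - A \<le> w y;
       \<And>y. w x - A / r ^ 2 * (norm (y - x0) ^ 2 - norm (x - x0) ^ 2) \<le> w y\<rbrakk>
      \<Longrightarrow> (LINT z|lborel. second_diff w x z * riesz_kernel (2 * s) z) \<le> C1 * A * r powr - (2 * s)"
    by (rule touching_second_diff_bound[OF s2, where 'a = "real^'n"]) blast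
  obtain C2 where C2': "C2 > 0" and time:
    "\<And>w t t0 A T.
      \<lbrakk>w differentiable (at t); 0 < T; 0 \<le> A; \<bar>t - t0\<bar> \<le> T;
       \<And>\<tau>. w t - A \<le> w \<tau>;
       \<And>\<tau>. w t - A / T ^ 2 * ((\<tau> - t0) ^ 2 - (t - t0) ^ 2) \<le> w \<tau>\<rbrakk>
      \<Longrightarrow> frac_time_deriv \<alpha> w t \<le> C2 * A * T powr - \<alpha>"
    by (rule touching_frac_time_deriv_bound[OF \<alpha>]) blast
  define C where "C = C2 + B * C1 + 2 * ?n"
  show ?thesis
  proof (rule that[of C])
    show "C > 0" using B C1' C2' by (simp add: C_def add_pos_nonneg)
    fix x0 :: "real^'n" and t0 A :: real
    assume nonneg: "\<And>x t. 0 \<le> u x t" and A: "0 \<le> A" and start: "u x0 t0 < A"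
    obtain x t where xt: "norm (x - x0) \<le> 1" "\<bar>t - t0\<bar> \<le> 1"
      and t1: "\<And>y \<tau>. y \<in> UNIV \<Longrightarrow> u x t - A \<le> u y \<tau>"
      and t2: "\<And>y. y \<in> UNIV \<Longrightarrow> u x t - A / 1 ^ 2 * (norm (y - x0) ^ 2 - norm (x - x0) ^ 2) \<le> u y t"
      and t3: "\<And>\<tau>. u x t - A / 1 ^ 2 * ((\<tau> - t0) ^ 2 - (t - t0) ^ 2) \<le> u x \<tau>"
    proof (rule touching_point[of x0 1 t0 1 u UNIV A 0])
    qed (use continuous_u A nonneg start in auto)
    have "frac_time_deriv \<alpha> (u x) t \<le> C2 * A * 1 powr - \<alpha>"
      by (rule time[OF _ _ _ xt(2)])
         (use C1[of x] A t1 t3 in \<open>auto simp: C1_differentiable_on_eq\<close>)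
    moreover have "frac_laplacian s (\<lambda>y. u y t) x \<le> B * (C1 * A * 1 powr - (2 * s))"
      unfolding frac_laplacian_eq_second_diff[OF C2 bound s] B_def[symmetric]
      using B
      by (intro mult_left_mono frac[OF second_diff_kernel_integrable[OF C2 bound s] zero_less_one A t1[OF UNIV_I] t2[OF UNIV_I]]) auto
    moreover have "- 2 * ?n * A / 1 ^ 2 \<le> laplacian (\<lambda>y. u y t) x"
      by (rule laplacian_touching[OF C2 t2]) simp
    ultimately have "master_operator s \<alpha> u x t \<le> C * A"
      by (simp add: master_operator_def C_def algebra_simps)
    then show "\<exists>x t. norm (x - x0) \<le> 1 \<and> \<bar>t - t0\<bar> \<le> 1 \<and> master_operator s \<alpha> u x t \<le> C * A"
      using xt by blast
  qed
qed

text \<open>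
Here \<open>- m\<close> is the infimum of the reflected difference on the left of the plane.  The estimate loses no
constant as the distance to the plane grows or shrinks, because the paraboloid is scaled with half of
that distance as space scale \<open>r\<close>, and with the time scale \<open>T\<close> for which \<open>T powr - \<alpha> = r powr - (2 * s)\<close>.  Only the
Laplacian contributes the worse factor \<open>r powr - 2\<close> for small \<open>r\<close>; but \<open>r\<close> is bounded below in terms of \<open>m\<close>, because
the reflected difference vanishes on the plane and is uniformly continuous.  The height \<open>A\<close> of the paraboloid may
depend on that lower bound, and \<open>c\<close> does not.
\<close>
lemma reflection_minimum_principle:
  fixes k :: 'n
  defines "e \<equiv> axis k 1 :: real^'n"
  obtains c where "c > 0" and
    "\<And>l m. \<lbrakk>m > 0; \<And>x t. x \<bullet> e < l \<Longrightarrow> - m \<le> u (reflect e l x) t - u x t;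
       \<And>m'. m' < m \<Longrightarrow> \<exists>x t. x \<bullet> e < l \<and> u (reflect e l x) t - u x t < - m'\<rbrakk>
      \<Longrightarrow> \<exists>x t. x \<bullet> e < l \<and> u (reflect e l x) t - u x t \<le> - m / 2 \<and>
            master_operator s \<alpha> u (reflect e l x) t - master_operator s \<alpha> u x t \<le> - c * m * (l - x \<bullet> e) powr - (2 * s)"
proof -
  let ?n = "real CARD('n)"
  have e: "e \<in> Basis" unfolding e_def by (simp add: axis_in_Basis_iff)
  define B where "B = frac_laplacian_const CARD('n) s / 2"
  have B: "B > 0" using const_pos by (simp add: B_def)
  have s2: "0 < 2 * s" "2 * s < 2" using s by auto
  obtain c1 C1 where c1: "c1 > 0" and C1': "C1 > 0" and frac:
    "\<And>(w :: real^'n \<Rightarrow> real) e l x x0 A m r M.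
      \<lbrakk>e \<in> Basis; w \<in> borel_measurable borel; \<And>y. w (reflect e l y) = - w y; \<And>y. \<bar>w y\<bar> \<le> M;
       integrable lborel (\<lambda>z. second_diff w x z * riesz_kernel (2 * s) z);
       0 < r; r \<le> l - x \<bullet> e; l - x \<bullet> e \<le> 3 * r; norm (x - x0) \<le> r; 0 \<le> A; 0 \<le> m;
       \<And>y. y \<bullet> e < l \<Longrightarrow> w x - A \<le> w y;
       \<And>y. y \<bullet> e < l \<Longrightarrow> w x - A / r ^ 2 * (norm (y - x0) ^ 2 - norm (x - x0) ^ 2) \<le> w y;
       2 * w x + A \<le> - m\<rbrakk>
      \<Longrightarrow> (LINT z|lborel. second_diff w x z * riesz_kernel (2 * s) z) \<le> (C1 * A - c1 * m) * r powr - (2 * s)"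
    by (rule antisymmetric_second_diff_bound[OF s2, where 'a = "real^'n"]) blast
  obtain C2 where C2': "C2 > 0" and time:
    "\<And>w t t0 A T.
      \<lbrakk>w differentiable (at t); 0 < T; 0 \<le> A; \<bar>t - t0\<bar> \<le> T;
       \<And>\<tau>. w t - A \<le> w \<tau>;
       \<And>\<tau>. w t - A / T ^ 2 * ((\<tau> - t0) ^ 2 - (t - t0) ^ 2) \<le> w \<tau>\<rbrakk>
      \<Longrightarrow> frac_time_deriv \<alpha> w t \<le> C2 * A * T powr - \<alpha>"
    by (rule touching_frac_time_deriv_bound[OF \<alpha>]) blast
  define c where "c = B * c1 / 2"
  show ?thesis
  proof (rule that[of c])
    show "c > 0" using B c1 by (simp add: c_def)
    fix l m :: real
    define w where "w x t = u (reflect e l x) t - u x t" for x t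
    assume m: "m > 0" and low: "\<And>x t. x \<bullet> e < l \<Longrightarrow> - m \<le> u (reflect e l x) t - u x t"
      and inf: "\<And>m'. m' < m \<Longrightarrow> \<exists>x t. x \<bullet> e < l \<and> u (reflect e l x) t - u x t < - m'"
    obtain \<delta> where \<delta>: "\<delta> > 0" "\<And>x y t. dist x y < \<delta> \<Longrightarrow> \<bar>u x t - u y t\<bar> < m / 2"
      using unif_cont[of "m / 2"] m by auto
    \<comment> \<open>The point and its image are \<open>4 r\<close> apart, so \<open>\<rho>\<close> is a lower bound for \<open>r\<close>.\<close>
    define \<rho> where "\<rho> = \<delta> / 4"
    have \<rho>: "\<rho> > 0" using \<delta> by (simp add: \<rho>_def)
    define Z where "Z = C2 + 2 * ?n * \<rho> powr - (2 - 2 * s) + B * C1"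
    have Z: "Z > 0" unfolding Z_def using C2' B C1' by (intro add_pos_pos add_pos_nonneg) auto
    \<comment> \<open>\<open>A * Z\<close> bounds all errors, and this choice lets them consume at most half of the gain \<open>B * c1 * m\<close>.\<close>
    define A where "A = min (m / 2) (B * c1 * m / (2 * Z))"
    have A: "A > 0" "A \<le> m / 2" "A * Z \<le> B * c1 * m / 2"
    proof -
      show "A > 0" "A \<le> m / 2" using m B c1 Z by (auto simp: A_def)
      have "A * Z \<le> B * c1 * m / (2 * Z) * Z" using Z by (intro mult_right_mono) (auto simp: A_def)
      then show "A * Z \<le> B * c1 * m / 2" using Z by simp
    qed
    obtain x0 t0 where x0: "x0 \<bullet> e < l" and w0: "w x0 t0 < - (m - A / 2)"
      using inf[of "m - A / 2"] A unfolding w_def by auto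
    define r where "r = (l - x0 \<bullet> e) / 2"
    have r: "r > 0" using x0 by (simp add: r_def)
    have r\<rho>: "\<rho> \<le> r"
    proof -
      have "\<not> dist (reflect e l x0) x0 < \<delta>" using \<delta>(2)[of "reflect e l x0" x0 t0] w0 A m by (auto simp: w_def)
      moreover have "dist (reflect e l x0) x0 = 4 * r" using e r by (simp add: dist_norm reflect_def r_def)
      ultimately show ?thesis by (simp add: \<rho>_def)
    qed
    define T where "T = r powr (2 * s / \<alpha>)"
    have T: "T > 0" using r by (simp add: T_def)
    have T\<alpha>: "T powr - \<alpha> = r powr - (2 * s)" using \<alpha> by (simp add: T_def powr_powr)
    have xe: "\<bar>x \<bullet> e - x0 \<bullet> e\<bar> \<le> norm (x - x0)" for x using Basis_le_norm[OF e, of "x - x0"] by (simp add: inner_diff_left)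
    have sub: "cball x0 r \<subseteq> {x. x \<bullet> e < l}"
    proof
      fix x assume "x \<in> cball x0 r"
      then have "norm (x - x0) \<le> r" by (simp add: dist_norm norm_minus_commute)
      then show "x \<in> {x. x \<bullet> e < l}" using xe[of x] r by (simp add: r_def)
    qed
    have contw: "continuous_on (cball x0 r \<times> cball t0 T) (\<lambda>(x, t). w x t)"
    proof -
      have "continuous_on (cball x0 r \<times> cball t0 T) (\<lambda>p. (\<lambda>(x, t). u x t) (reflect e l (fst p), snd p) - (\<lambda>(x, t). u x t) p)"
        by (intro continuous_on_diff continuous_u continuous_on_compose2[OF continuous_u[of UNIV]]
             continuous_on_Pair continuous_on_compose2[OF reflect_continuous[of UNIV]] continuous_on_fst continuous_on_snd continuous_on_id) auto
      then show ?thesis by (simp add: w_def case_prod_beta)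
    qed
    obtain x t where xr: "norm (x - x0) \<le> r" and tT: "\<bar>t - t0\<bar> \<le> T" and wle: "w x t \<le> w x0 t0"
      and t1: "\<And>y \<tau>. y \<in> {x. x \<bullet> e < l} \<Longrightarrow> w x t - A \<le> w y \<tau>"
      and t2: "\<And>y. y \<in> {x. x \<bullet> e < l} \<Longrightarrow> w x t - A / r ^ 2 * (norm (y - x0) ^ 2 - norm (x - x0) ^ 2) \<le> w y t"
      and t3: "\<And>\<tau>. w x t - A / T ^ 2 * ((\<tau> - t0) ^ 2 - (t - t0) ^ 2) \<le> w x \<tau>"
    proof (rule touching_point[OF contw r T sub, of A m])
    qed (use A m low w0 in \<open>auto simp: w_def\<close>)
    have xl: "x \<bullet> e < l" "r \<le> l - x \<bullet> e" "l - x \<bullet> e \<le> 3 * r"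
      using xe[of x] xr r by (auto simp: r_def)
    define d where "d = l - x \<bullet> e"
    have wneg: "2 * w x t + A \<le> - m" "w x t \<le> - m / 2" using wle w0 A by auto
    have time': "frac_time_deriv \<alpha> (u (reflect e l x)) t - frac_time_deriv \<alpha> (u x) t \<le> C2 * A * r powr - (2 * s)"
    proof -
      have "frac_time_deriv \<alpha> (u (reflect e l x)) t - frac_time_deriv \<alpha> (u x) t = frac_time_deriv \<alpha> (w x) t"
        using frac_time_deriv_diff[OF \<alpha> C1 bound C1 bound] by (simp add: w_def[abs_def])
      also have "\<dots> \<le> C2 * A * T powr - \<alpha>"
      proof (rule time[OF _ T _ tT])
        have "u y differentiable (at t)" for y
          using C1[of y] by (auto simp: C1_differentiable_on_eq)
        then show "w x differentiable (at t)" unfolding w_def[abs_def] by (intro differentiable_diff)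
      qed (use A t1 t3 xl in auto)
      finally show ?thesis by (simp add: T\<alpha>)
    qed
    have frac': "frac_laplacian s (\<lambda>y. u y t) (reflect e l x) - frac_laplacian s (\<lambda>y. u y t) x
        \<le> B * ((C1 * A - c1 * m) * r powr - (2 * s))"
    proof -
      have meas: "(\<lambda>y. u y t) \<in> borel_measurable borel"
        by (intro borel_measurable_continuous_onI C2_continuous C2)
      note diff = frac_laplacian_reflect_diff[where l = l and x = x and v = "\<lambda>y. u y t", OF C2 bound s e, folded w_def]
      have "(LINT z|lborel. second_diff (\<lambda>y. w y t) x z * riesz_kernel (2 * s) z) \<le> (C1 * A - c1 * m) * r powr - (2 * s)"
      proof (rule frac[where w = "\<lambda>y. w y t" and e = e and l = l and x = x and x0 = x0 and A = A and m = m and r = r and M = "2 * M", OF e _ _ _ diff(1) r xl(2,3) xr])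
        show "(\<lambda>y. w y t) \<in> borel_measurable borel" unfolding w_def using meas by measurable
        show "w (reflect e l y) t = - w y t" for y by (simp add: w_def e)
        show "\<bar>w y t\<bar> \<le> 2 * M" for y
          using bound[of "reflect e l y" t] bound[of y t] by (simp add: w_def)
      qed (use A m t1 t2 wneg in auto)
      from mult_left_mono[OF this less_imp_le[OF B]] show ?thesis
        using diff(2) by (simp add: B_def)
    qed
    have lap': "- 2 * ?n * A / r ^ 2 \<le> laplacian (\<lambda>y. u y t) (reflect e l x) - laplacian (\<lambda>y. u y t) x"
      unfolding e_def
    proof (rule laplacian_reflect_touching[OF C2 r])
      show "x \<bullet> axis k 1 < l" using xl by (simp add: e_def)
    qed (use t2 in \<open>auto simp: w_def e_def\<close>)
    have r2: "1 / r ^ 2 \<le> \<rho> powr - (2 - 2 * s) * r powr - (2 * s)"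
    proof -
      have "1 / r ^ 2 = r powr - (2 - 2 * s) * r powr - (2 * s)"
        using r powr_minus_divide[of r 2] by (simp flip: powr_add)
      also have "\<dots> \<le> \<rho> powr - (2 - 2 * s) * r powr - (2 * s)"
        using \<rho> r\<rho> s by (intro mult_right_mono powr_mono2') auto
      finally show ?thesis .
    qed
    have "2 * ?n * A / r ^ 2 \<le> 2 * ?n * A * (\<rho> powr - (2 - 2 * s) * r powr - (2 * s))"
      using mult_left_mono[OF r2, of "2 * ?n * A"] A by simp
    then have "master_operator s \<alpha> u (reflect e l x) t - master_operator s \<alpha> u x t
        \<le> C2 * A * r powr - (2 * s) + B * ((C1 * A - c1 * m) * r powr - (2 * s)) + 2 * ?n * A * (\<rho> powr - (2 - 2 * s) * r powr - (2 * s))"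
      using time' frac' lap' unfolding master_operator_def by linarith
    also have "\<dots> = (A * Z - B * c1 * m) * r powr - (2 * s)" by (simp add: Z_def algebra_simps)
    also have "\<dots> \<le> (- c * m) * r powr - (2 * s)" using A by (intro mult_right_mono) (auto simp: c_def)
    also have "\<dots> \<le> (- c * m) * d powr - (2 * s)"
      using B c1 m r xl s by (intro mult_left_mono_neg powr_mono2') (auto simp: c_def d_def)
    finally show "\<exists>x t. x \<bullet> e < l \<and> u (reflect e l x) t - u x t \<le> - m / 2 \<and>
            master_operator s \<alpha> u (reflect e l x) t - master_operator s \<alpha> u x t \<le> - c * m * (l - x \<bullet> e) powr - (2 * s)"
      using xl wneg unfolding w_def d_def by blast
  qed
qed

end

section \<open>Quantitative consequences of the hypotheses on the nonlinearity\<close>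

text \<open>
Near \<open>0\<close> the function \<open>g\<close> is continuously differentiable with \<open>g' 0 = 0\<close>, so the mean value theorem applies.
\<close>
lemma F2_small_slope:
  assumes g: "condition_F2 g" and \<eta>: "\<eta> > 0"
  obtains \<epsilon> where "\<epsilon> > 0" "\<And>a b. 0 < a \<Longrightarrow> a \<le> b \<Longrightarrow> b \<le> \<epsilon> \<Longrightarrow> g b - g a \<le> \<eta> * (b - a)"
proof -
  obtain \<delta> g' where \<delta>: "\<delta> > 0"
    and D: "\<And>r. r \<in> {0..<\<delta>} \<Longrightarrow> (g has_real_derivative g' r) (at r within {0..})"
    and c: "continuous_on {0..<\<delta>} g'" and g'0: "g' 0 = 0"
    using g unfolding condition_F2_def by blast
  have "0 \<in> {0..<\<delta>}" using \<delta> by simp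
  then obtain d where d: "d > 0" and dd: "\<And>r. r \<in> {0..<\<delta>} \<Longrightarrow> dist r 0 < d \<Longrightarrow> dist (g' r) (g' 0) < \<eta>"
    using c \<eta> unfolding continuous_on_iff by metis
  define \<epsilon> where "\<epsilon> = min d \<delta> / 2"
  have \<epsilon>: "\<epsilon> > 0" "\<epsilon> < d" "\<epsilon> < \<delta>" using d \<delta> by (auto simp: \<epsilon>_def)
  show ?thesis
  proof (rule that[OF \<epsilon>(1)])
    fix a b :: real assume ab: "0 < a" "a \<le> b" "b \<le> \<epsilon>"
    show "g b - g a \<le> \<eta> * (b - a)"
    proof (cases "a = b")
      case False
      have der: "(g has_real_derivative g' r) (at r)" if "a \<le> r" "r \<le> b" for r
      proof -
        have "at r within {0..} = at r" using that ab by (intro at_within_interior) auto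
        then show ?thesis using D[of r] that ab \<epsilon> by auto
      qed
      obtain z where z: "a < z" "z < b" "g b - g a = (b - a) * g' z"
        using MVT2[of a b g g'] der ab False by auto
      have "g' z \<le> \<eta>" using dd[of z] z ab \<epsilon> g'0 by (simp add: dist_real_def)
      then have "(b - a) * g' z \<le> (b - a) * \<eta>" using ab by (intro mult_left_mono) auto
      then show ?thesis using z by (simp add: mult.commute)
    qed simp
  qed
qed

text \<open>
Local Lipschitz continuity on \<open>{0<..}\<close> gives no uniform constant near \<open>0\<close>; there the vanishing slope is used.
\<close>
lemma F2_lipschitz:
  assumes g: "condition_F2 g"
  obtains \<Lambda> where "\<Lambda> > 0" "\<And>a b. 0 < a \<Longrightarrow> a \<le> b \<Longrightarrow> b \<le> M \<Longrightarrow> g b - g a \<le> \<Lambda> * (b - a)"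
proof -
  obtain \<epsilon> where \<epsilon>: "\<epsilon> > 0" "\<And>a b. 0 < a \<Longrightarrow> a \<le> b \<Longrightarrow> b \<le> \<epsilon> \<Longrightarrow> g b - g a \<le> 1 * (b - a)"
    using F2_small_slope[OF g zero_less_one] by blast
  have "local_lipschitz UNIV {0<..} (\<lambda>_::real. g)" using g by (simp add: condition_F2_def)
  then have "local_lipschitz {0::real} {\<epsilon>..M} (\<lambda>_. g)"
    by (rule local_lipschitz_subset) (use \<epsilon> in auto)
  then obtain L where L: "L-lipschitz_on {\<epsilon>..M} g"
    using local_lipschitz_compact_implies_lipschitz[of "{0::real}" "{\<epsilon>..M}" "\<lambda>_. g"] by (auto simp: continuous_on_const)
  define \<Lambda> where "\<Lambda> = max 1 L"
  have high: "g b - g a \<le> \<Lambda> * (b - a)" if "\<epsilon> \<le> a" "a \<le> b" "b \<le> M" for a b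
  proof -
    have "g b - g a \<le> L * (b - a)" using lipschitz_onD[OF L, of b a] that by (simp add: dist_real_def)
    also have "\<dots> \<le> \<Lambda> * (b - a)" using that by (intro mult_right_mono) (auto simp: \<Lambda>_def)
    finally show ?thesis .
  qed
  have low: "g b - g a \<le> \<Lambda> * (b - a)" if "0 < a" "a \<le> b" "b \<le> \<epsilon>" for a b
  proof -
    have "1 * (b - a) \<le> \<Lambda> * (b - a)" using that by (intro mult_right_mono) (auto simp: \<Lambda>_def)
    then show ?thesis using \<epsilon>(2)[OF that] by linarith
  qed
  show ?thesis
  proof (rule that[of \<Lambda>])
    show "\<Lambda> > 0" by (simp add: \<Lambda>_def)
    fix a b assume ab: "0 < a" "a \<le> b" "b \<le> M"
    consider "b \<le> \<epsilon>" | "\<epsilon> \<le> a" | "a \<le> \<epsilon>" "\<epsilon> \<le> b" by linarith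
    then show "g b - g a \<le> \<Lambda> * (b - a)"
    proof cases
      case 3
      then show ?thesis using low[of a \<epsilon>] high[of \<epsilon> b] ab by (simp add: right_diff_distrib)
    qed (use low high ab in auto)
  qed
qed

lemma F1_decay:
  assumes f: "condition_F1 s f" and \<eta>: "\<eta> > 0"
  obtains R where "R > 0" "\<And>x. x \<le> - R \<Longrightarrow> f x \<le> \<eta> * \<bar>x\<bar> powr - (2 * s)"
proof -
  have "Limsup at_bot (\<lambda>r. ereal (f r * \<bar>r\<bar> powr (2 * s))) < ereal \<eta>"
    using f \<eta> unfolding condition_F1_def by (metis ereal_less(2) le_less_trans)
  then have "eventually (\<lambda>r. ereal (f r * \<bar>r\<bar> powr (2 * s)) < ereal \<eta>) at_bot"
    by (rule Limsup_lessD)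
  then obtain N where N: "\<And>r. r \<le> N \<Longrightarrow> f r * \<bar>r\<bar> powr (2 * s) < \<eta>"
    by (auto simp: eventually_at_bot_linorder)
  show ?thesis
  proof (rule that[of "\<bar>N\<bar> + 1"])
    fix x assume "x \<le> - (\<bar>N\<bar> + 1)"
    then have "f x * \<bar>x\<bar> powr (2 * s) < \<eta>" "\<bar>x\<bar> > 0" using N[of x] by auto
    then show "f x \<le> \<eta> * \<bar>x\<bar> powr - (2 * s)" by (simp add: powr_minus_divide field_simps)
  qed simp
qed

text \<open>
The function \<open>f\<close> may be discontinuous, so compactness is of no help.  Any interval of length \<open>\<delta>\<close> contains a cell of the grid of
mesh \<open>\<delta> / 2\<close>, and only finitely many cells meet the range of \<open>p\<close>.
\<close>
lemma strict_mono_uniform_gap: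
  fixes f :: "real \<Rightarrow> real"
  assumes f: "strict_mono f" and \<delta>: "\<delta> > 0"
  obtains \<kappa> where "\<kappa> > 0" "\<And>p q. a \<le> p \<Longrightarrow> p \<le> b \<Longrightarrow> p + \<delta> \<le> q \<Longrightarrow> \<kappa> \<le> f q - f p"
proof -
  define y where "y i = a + real i * (\<delta> / 2)" for i :: nat
  define N where "N = nat \<lceil>(b - a) / (\<delta> / 2)\<rceil>"
  define \<kappa> where "\<kappa> = Min ((\<lambda>i. f (y (Suc (Suc i))) - f (y (Suc i))) ` {..N})"
  have "f (y (Suc i)) < f (y (Suc (Suc i)))" for i
    using \<delta> by (intro strict_monoD[OF f]) (simp add: y_def)
  then have \<kappa>: "\<kappa> > 0" by (simp add: \<kappa>_def)
  show ?thesis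
  proof (rule that[OF \<kappa>])
    fix p q assume p: "a \<le> p" "p \<le> b" and q: "p + \<delta> \<le> q"
    define i where "i = nat \<lfloor>(p - a) / (\<delta> / 2)\<rfloor>"
    have pos: "0 \<le> (p - a) / (\<delta> / 2)" using p \<delta> by simp
    have i: "real i \<le> (p - a) / (\<delta> / 2)" "(p - a) / (\<delta> / 2) < real i + 1"
      using pos by (auto simp: i_def)
    have "(p - a) / (\<delta> / 2) \<le> (b - a) / (\<delta> / 2)" using p \<delta> by (intro divide_right_mono) auto
    then have iN: "i \<in> {..N}" unfolding i_def N_def atMost_iff using pos
      by (intro nat_mono) linarith
    have 1: "p \<le> y (Suc i)" using i(2) \<delta> by (simp add: y_def field_simps)
    have 2: "y (Suc (Suc i)) \<le> q" using i(1) \<delta> q by (simp add: y_def field_simps)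
    have "\<kappa> \<le> f (y (Suc (Suc i))) - f (y (Suc i))" unfolding \<kappa>_def using iN by (intro Min_le) auto
    moreover have "f p \<le> f (y (Suc i))" "f (y (Suc (Suc i))) \<le> f q"
      using strict_mono_mono[OF f] 1 2 by (auto dest: monoD)
    ultimately show "\<kappa> \<le> f q - f p" by linarith
  qed
qed

section \<open>Moving planes\<close>

locale positive_solution = regular_bounded_function s \<alpha> M u
  for s \<alpha> M :: real and u :: "real^'n::finite \<Rightarrow> real \<Rightarrow> real" +
  fixes k :: 'n and f g :: "real \<Rightarrow> real"
  assumes pos: "\<And>x t. u x t > 0"
    and equation: "\<And>x t. master_operator s \<alpha> u x t = f (x $ k) * g (u x t)"
    and F1: "condition_F1 s f" and F2: "condition_F2 g"
begin

definition e :: "real^'n" where "e = axis k 1"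

lemma e_Basis: "e \<in> Basis" by (simp add: e_def axis_in_Basis_iff)

lemma inner_e: "x \<bullet> e = x $ k" by (simp add: e_def cart_eq_inner_axis)

lemma f_mono: "x \<le> y \<Longrightarrow> f x \<le> f y"
  using F1 by (simp add: condition_F1_def strict_mono_less_eq)

lemma g_pos: "0 < r \<Longrightarrow> 0 < g r"
  using F2 by (simp add: condition_F2_def)

lemma g_mono: "0 < a \<Longrightarrow> a \<le> b \<Longrightarrow> g a \<le> g b"
  using F2 by (auto simp: condition_F2_def mono_on_def)

lemma u_le: "u x t \<le> M" using bound[of x t] by simp

definition plane_ok :: "real \<Rightarrow> bool" where
  "plane_ok l \<longleftrightarrow> (\<forall>x t. x \<bullet> e < l \<longrightarrow> u x t \<le> u (reflect e l x) t)"

text \<open>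
The minimum principle, combined with the equation at the point found and at its mirror image.  The number \<open>m\<close> is
the supremum of \<open>u\<close> minus its reflection.
\<close>
lemma negative_reflection_point:
  obtains c where "c > 0" and
    "\<And>l. \<not> plane_ok l \<Longrightarrow> \<exists>m x t. m > 0 \<and>
       (\<forall>\<mu>. (\<forall>x t. x \<bullet> e < l \<longrightarrow> - \<mu> \<le> u (reflect e l x) t - u x t) \<longrightarrow> m \<le> \<mu>) \<and>
       x \<bullet> e < l \<and> u (reflect e l x) t < u x t \<and> u x t - u (reflect e l x) t \<le> m \<and>
       (f (2 * l - x \<bullet> e) - f (x \<bullet> e)) * g (u (reflect e l x) t) + c * m * (l - x \<bullet> e) powr - (2 * s)
         \<le> f (x \<bullet> e) * (g (u x t) - g (u (reflect e l x) t))"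
proof -
  obtain c where c: "c > 0" and principle:
    "\<And>l m. \<lbrakk>m > 0; \<And>x t. x \<bullet> e < l \<Longrightarrow> - m \<le> u (reflect e l x) t - u x t;
       \<And>m'. m' < m \<Longrightarrow> \<exists>x t. x \<bullet> e < l \<and> u (reflect e l x) t - u x t < - m'\<rbrakk>
      \<Longrightarrow> \<exists>x t. x \<bullet> e < l \<and> u (reflect e l x) t - u x t \<le> - m / 2 \<and>
            master_operator s \<alpha> u (reflect e l x) t - master_operator s \<alpha> u x t \<le> - c * m * (l - x \<bullet> e) powr - (2 * s)"
    unfolding e_def by (rule reflection_minimum_principle[of k]) blast
  show ?thesis
  proof (rule that[OF c])
    fix l assume "\<not> plane_ok l"
    then obtain x1 t1 where x1: "x1 \<bullet> e < l" "u (reflect e l x1) t1 < u x1 t1"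
      by (auto simp: plane_ok_def not_le)
    define W where "W = {u x t - u (reflect e l x) t | x t. x \<bullet> e < l}"
    define m where "m = Sup W"
    have bdd: "bdd_above W"
    proof (rule bdd_aboveI[of _ M])
      fix a assume "a \<in> W"
      then obtain x t where "a = u x t - u (reflect e l x) t" by (auto simp: W_def)
      then show "a \<le> M" using u_le[of x t] pos[of "reflect e l x" t] by simp
    qed
    have in_W: "u x t - u (reflect e l x) t \<in> W" if "x \<bullet> e < l" for x t using that by (auto simp: W_def)
    have ne: "W \<noteq> {}" using in_W[OF x1(1)] by blast
    have m: "m > 0" using cSup_upper[OF in_W[OF x1(1), of t1] bdd] x1(2) by (simp add: m_def)
    have low: "- m \<le> u (reflect e l x) t - u x t" if "x \<bullet> e < l" for x t
      using cSup_upper[OF in_W[OF that, of t] bdd] by (simp add: m_def)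
    have "\<exists>x t. x \<bullet> e < l \<and> u (reflect e l x) t - u x t < - m'" if m': "m' < m" for m'
    proof -
      obtain a where "a \<in> W" "m' < a" using m' less_cSup_iff[OF ne bdd, of m'] by (auto simp: m_def)
      then obtain x t where "x \<bullet> e < l" "m' < u x t - u (reflect e l x) t" by (auto simp: W_def)
      then have "x \<bullet> e < l \<and> u (reflect e l x) t - u x t < - m'" by simp
      then show ?thesis by blast
    qed
    from principle[OF m low this] obtain x t where xt: "x \<bullet> e < l" "u (reflect e l x) t - u x t \<le> - m / 2"
      and L: "master_operator s \<alpha> u (reflect e l x) t - master_operator s \<alpha> u x t \<le> - c * m * (l - x \<bullet> e) powr - (2 * s)"
      by blast
    have "reflect e l x $ k = 2 * l - x \<bullet> e" using reflect_inner[OF e_Basis, of l x] by (simp add: inner_e)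
    then have "f (2 * l - x \<bullet> e) * g (u (reflect e l x) t) - f (x \<bullet> e) * g (u x t) \<le> - (c * m * (l - x \<bullet> e) powr - (2 * s))"
      using L by (simp add: equation inner_e)
    then have "(f (2 * l - x \<bullet> e) - f (x \<bullet> e)) * g (u (reflect e l x) t) + c * m * (l - x \<bullet> e) powr - (2 * s)
         \<le> f (x \<bullet> e) * (g (u x t) - g (u (reflect e l x) t))"
      by (simp add: algebra_simps)
    moreover have "m \<le> \<mu>" if "\<forall>x t. x \<bullet> e < l \<longrightarrow> - \<mu> \<le> u (reflect e l x) t - u x t" for \<mu>
      unfolding m_def
    proof (rule cSup_least[OF ne])
      fix a assume "a \<in> W"
      then obtain y \<tau> where "y \<bullet> e < l" "a = u y \<tau> - u (reflect e l y) \<tau>" by (auto simp: W_def)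
      then show "a \<le> \<mu>" using that[rule_format, of y \<tau>] by simp
    qed
    moreover have "u (reflect e l x) t < u x t" using xt(2) m by linarith
    moreover have "u x t - u (reflect e l x) t \<le> m" using low[OF xt(1), of t] by linarith
    ultimately show "\<exists>m x t. m > 0 \<and>
       (\<forall>\<mu>. (\<forall>x t. x \<bullet> e < l \<longrightarrow> - \<mu> \<le> u (reflect e l x) t - u x t) \<longrightarrow> m \<le> \<mu>) \<and>
       x \<bullet> e < l \<and> u (reflect e l x) t < u x t \<and> u x t - u (reflect e l x) t \<le> m \<and>
       (f (2 * l - x \<bullet> e) - f (x \<bullet> e)) * g (u (reflect e l x) t) + c * m * (l - x \<bullet> e) powr - (2 * s)
         \<le> f (x \<bullet> e) * (g (u x t) - g (u (reflect e l x) t))"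
      using m xt(1) by blast
  qed
qed

text \<open>
The point supplied by \<open>negative_reflection_point\<close> is confronted with the behaviour of \<open>f\<close> and \<open>g\<close>.  First, \<open>f > 0\<close> at
the point, as otherwise the right-hand side would not be positive, and the point cannot lie far to the
left at a comparable distance from the plane, by the decay of \<open>f\<close>.  All planes that are themselves far
to the left are covered by this.  For the other planes \<open>l \<le> l0\<close> the distance to the plane is confined
to an interval \<open>\<delta> < d < D\<close>, the value of \<open>u\<close> at the point exceeds some \<open>\<epsilon>\<close>, and the increase of \<open>f\<close> between the
point and its image then bounds \<open>m\<close> from below.
\<close>
lemma plane_dichotomy:
  obtains R where "\<And>l. l \<le> - R \<Longrightarrow> plane_ok l"
    and "\<And>l0. \<exists>\<mu>>0. \<forall>l\<le>l0. (\<forall>x t. x \<bullet> e < l \<longrightarrow> - \<mu> \<le> u (reflect e l x) t - u x t) \<longrightarrow> plane_ok l"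
proof -
  obtain c where c: "c > 0" and neg:
    "\<And>l. \<not> plane_ok l \<Longrightarrow> \<exists>m x t. m > 0 \<and>
       (\<forall>\<mu>. (\<forall>x t. x \<bullet> e < l \<longrightarrow> - \<mu> \<le> u (reflect e l x) t - u x t) \<longrightarrow> m \<le> \<mu>) \<and>
       x \<bullet> e < l \<and> u (reflect e l x) t < u x t \<and> u x t - u (reflect e l x) t \<le> m \<and>
       (f (2 * l - x \<bullet> e) - f (x \<bullet> e)) * g (u (reflect e l x) t) + c * m * (l - x \<bullet> e) powr - (2 * s)
         \<le> f (x \<bullet> e) * (g (u x t) - g (u (reflect e l x) t))"
    by (rule negative_reflection_point) blast
  obtain \<Lambda> where \<Lambda>: "\<Lambda> > 0" and lip: "\<And>a b. 0 < a \<Longrightarrow> a \<le> b \<Longrightarrow> b \<le> M \<Longrightarrow> g b - g a \<le> \<Lambda> * (b - a)"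
    using F2_lipschitz[OF F2, of M] by blast
  \<comment> \<open>The factor \<open>2 powr - (2 * s)\<close> allows for a distance to the plane of up to \<open>2 * \<bar>x \<bullet> e\<bar>\<close>.\<close>
  define \<eta> where "\<eta> = c / (2 * \<Lambda>) * 2 powr - (2 * s)"
  have \<eta>: "\<eta> > 0" using c \<Lambda> by (simp add: \<eta>_def)
  obtain R where R: "R > 0" and decay: "\<And>x. x \<le> - R \<Longrightarrow> f x \<le> \<eta> * \<bar>x\<bar> powr - (2 * s)"
    using F1_decay[OF F1 \<eta>] by blast
  have point: "\<exists>m x t. m > 0 \<and>
       (\<forall>\<mu>. (\<forall>x t. x \<bullet> e < l \<longrightarrow> - \<mu> \<le> u (reflect e l x) t - u x t) \<longrightarrow> m \<le> \<mu>) \<and>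
       x \<bullet> e < l \<and> f (x \<bullet> e) > 0 \<and> u (reflect e l x) t < u x t \<and> u x t - u (reflect e l x) t \<le> m \<and>
       c * m * (l - x \<bullet> e) powr - (2 * s) \<le> f (x \<bullet> e) * (g (u x t) - g (u (reflect e l x) t)) \<and>
       (f (2 * l - x \<bullet> e) - f (x \<bullet> e)) * g (u (reflect e l x) t) \<le> f (x \<bullet> e) * (\<Lambda> * m) \<and>
       c * (l - x \<bullet> e) powr - (2 * s) \<le> f (x \<bullet> e) * \<Lambda> \<and>
       \<not> (x \<bullet> e \<le> - R \<and> l - x \<bullet> e \<le> 2 * \<bar>x \<bullet> e\<bar>)" if bad: "\<not> plane_ok l" for l
  proof -
    obtain m x t where m: "m > 0" and
       minf: "\<forall>\<mu>. (\<forall>x t. x \<bullet> e < l \<longrightarrow> - \<mu> \<le> u (reflect e l x) t - u x t) \<longrightarrow> m \<le> \<mu>"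
      and x: "x \<bullet> e < l" and v: "u (reflect e l x) t < u x t" "u x t - u (reflect e l x) t \<le> m"
      and main: "(f (2 * l - x \<bullet> e) - f (x \<bullet> e)) * g (u (reflect e l x) t) + c * m * (l - x \<bullet> e) powr - (2 * s)
         \<le> f (x \<bullet> e) * (g (u x t) - g (u (reflect e l x) t))"
      using neg[OF bad] by blast
    define d where "d = l - x \<bullet> e"
    have d: "d > 0" using x by (simp add: d_def)
    have cm: "c * m * d powr - (2 * s) > 0" using c m d by simp
    have gap: "0 \<le> (f (2 * l - x \<bullet> e) - f (x \<bullet> e)) * g (u (reflect e l x) t)"
      using f_mono[of "x \<bullet> e" "2 * l - x \<bullet> e"] x g_pos[OF pos[of "reflect e l x" t]] by simp
    have g0: "0 \<le> g (u x t) - g (u (reflect e l x) t)" using g_mono[OF pos, of "reflect e l x" t "u x t"] v by simp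
    have first: "c * m * d powr - (2 * s) \<le> f (x \<bullet> e) * (g (u x t) - g (u (reflect e l x) t))"
      using main gap by (simp add: d_def)
    have fpos: "f (x \<bullet> e) > 0"
    proof (rule ccontr)
      assume "\<not> f (x \<bullet> e) > 0"
      then have "f (x \<bullet> e) * (g (u x t) - g (u (reflect e l x) t)) \<le> 0" using g0 by (simp add: mult_nonpos_nonneg)
      then show False using first cm by linarith
    qed
    have "g (u x t) - g (u (reflect e l x) t) \<le> \<Lambda> * (u x t - u (reflect e l x) t)"
      using lip[OF pos _ u_le, of "reflect e l x" t] v by simp
    also have "\<dots> \<le> \<Lambda> * m" using v \<Lambda> by (intro mult_left_mono) auto
    finally have upper: "f (x \<bullet> e) * (g (u x t) - g (u (reflect e l x) t)) \<le> f (x \<bullet> e) * (\<Lambda> * m)"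
      using fpos by (intro mult_left_mono) auto
    have second: "(f (2 * l - x \<bullet> e) - f (x \<bullet> e)) * g (u (reflect e l x) t) \<le> f (x \<bullet> e) * (\<Lambda> * m)"
      using main upper cm by (simp add: d_def)
    have "(c * d powr - (2 * s)) * m \<le> (f (x \<bullet> e) * \<Lambda>) * m" using first upper by (simp add: mult_ac)
    then have third: "c * d powr - (2 * s) \<le> f (x \<bullet> e) * \<Lambda>" using m by simp
    have "\<not> (x \<bullet> e \<le> - R \<and> d \<le> 2 * \<bar>x \<bullet> e\<bar>)"
    proof
      assume far: "x \<bullet> e \<le> - R \<and> d \<le> 2 * \<bar>x \<bullet> e\<bar>"
      have "f (x \<bullet> e) * \<Lambda> \<le> (\<eta> * \<bar>x \<bullet> e\<bar> powr - (2 * s)) * \<Lambda>"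
        using decay far \<Lambda> by (intro mult_right_mono) auto
      also have "\<dots> = c / 2 * (2 * \<bar>x \<bullet> e\<bar>) powr - (2 * s)" using \<Lambda> by (simp add: \<eta>_def powr_mult)
      also have "\<dots> \<le> c / 2 * d powr - (2 * s)" using c d far s by (intro mult_left_mono powr_mono2') auto
      also have "\<dots> < c * d powr - (2 * s)" using c d by simp
      finally show False using third by linarith
    qed
    then show ?thesis using m minf x v first second third fpos unfolding d_def by blast
  qed
  show ?thesis
  proof (rule that[of R])
    fix l assume l: "l \<le> - R"
    show "plane_ok l"
    proof (rule ccontr)
      assume "\<not> plane_ok l"
      from point[OF this] obtain x where "x \<bullet> e < l" "\<not> (x \<bullet> e \<le> - R \<and> l - x \<bullet> e \<le> 2 * \<bar>x \<bullet> e\<bar>)" by blast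
      then show False using l R by linarith
    qed
  next
    fix l0 :: real
    define F where "F = max (f l0) 1"
    have F: "F > 0" "F \<ge> f l0" by (auto simp: F_def)
    \<comment> \<open>Points at distance at least \<open>D\<close> are far to the left and at most \<open>2 * \<bar>x \<bullet> e\<bar>\<close> away from the plane.\<close>
    define D where "D = 2 * \<bar>l0\<bar> + 2 * R"
    have D: "D > 0" using R by (simp add: D_def)
    \<comment> \<open>At distance at most \<open>\<delta>\<close> from the plane the gain is at least \<open>2 * F * \<Lambda>\<close>, beyond the size of the right-hand side.\<close>
    define \<delta> where "\<delta> = (c / (2 * F * \<Lambda>)) powr (1 / (2 * s))"
    have \<delta>: "\<delta> > 0" "c * \<delta> powr - (2 * s) = 2 * F * \<Lambda>"
      using c F \<Lambda> s by (auto simp: \<delta>_def powr_powr powr_minus_divide)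
    obtain \<epsilon> where \<epsilon>: "\<epsilon> > 0"
      and slope: "\<And>a b. 0 < a \<Longrightarrow> a \<le> b \<Longrightarrow> b \<le> \<epsilon> \<Longrightarrow> g b - g a \<le> c * D powr - (2 * s) / (2 * F) * (b - a)"
      using F2_small_slope[OF F2, of "c * D powr - (2 * s) / (2 * F)"] c D F by auto
    obtain \<kappa> where \<kappa>: "\<kappa> > 0" and gap: "\<And>p q. - R - D \<le> p \<Longrightarrow> p \<le> l0 \<Longrightarrow> p + \<delta> \<le> q \<Longrightarrow> \<kappa> \<le> f q - f p"
      using strict_mono_uniform_gap[of f \<delta> "- R - D" l0] F1 \<delta> by (auto simp: condition_F1_def)
    define \<mu> where "\<mu> = min (\<epsilon> / 2) (\<kappa> * g (\<epsilon> / 2) / (2 * F * \<Lambda>))"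
    have g\<epsilon>: "g (\<epsilon> / 2) > 0" using \<epsilon> by (intro g_pos) auto
    have \<mu>: "\<mu> > 0" using \<epsilon> \<kappa> g\<epsilon> F \<Lambda> by (simp add: \<mu>_def)
    have "plane_ok l" if l: "l \<le> l0" and near: "\<forall>x t. x \<bullet> e < l \<longrightarrow> - \<mu> \<le> u (reflect e l x) t - u x t" for l
    proof (rule ccontr)
      assume bad: "\<not> plane_ok l"
      obtain m x t where m: "m > 0" and
         minf: "\<forall>\<mu>. (\<forall>x t. x \<bullet> e < l \<longrightarrow> - \<mu> \<le> u (reflect e l x) t - u x t) \<longrightarrow> m \<le> \<mu>"
        and x: "x \<bullet> e < l" and fpos: "f (x \<bullet> e) > 0"
        and v: "u (reflect e l x) t < u x t" "u x t - u (reflect e l x) t \<le> m"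
        and first: "c * m * (l - x \<bullet> e) powr - (2 * s) \<le> f (x \<bullet> e) * (g (u x t) - g (u (reflect e l x) t))"
        and second: "(f (2 * l - x \<bullet> e) - f (x \<bullet> e)) * g (u (reflect e l x) t) \<le> f (x \<bullet> e) * (\<Lambda> * m)"
        and third: "c * (l - x \<bullet> e) powr - (2 * s) \<le> f (x \<bullet> e) * \<Lambda>"
        and notfar: "\<not> (x \<bullet> e \<le> - R \<and> l - x \<bullet> e \<le> 2 * \<bar>x \<bullet> e\<bar>)"
        using point[OF bad] by blast
      define d where "d = l - x \<bullet> e"
      have d: "d > 0" using x by (simp add: d_def)
      have fF: "f (x \<bullet> e) \<le> F" using f_mono[of "x \<bullet> e" l0] x l F by linarith
      have dD: "d < D" using notfar l R unfolding d_def D_def by linarith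
      have lR: "- R \<le> l" using notfar x R by linarith
      have "\<delta> < d"
      proof (rule ccontr)
        assume "\<not> \<delta> < d"
        then have "c * \<delta> powr - (2 * s) \<le> c * d powr - (2 * s)"
          using c d s by (intro mult_left_mono powr_mono2') auto
        also have "\<dots> \<le> F * \<Lambda>" using third mult_right_mono[OF fF less_imp_le[OF \<Lambda>]] by (simp add: d_def)
        finally show False using \<delta>(2) F \<Lambda> by simp
      qed
      have "\<epsilon> < u x t"
      proof (rule ccontr)
        assume "\<not> \<epsilon> < u x t"
        then have "g (u x t) - g (u (reflect e l x) t) \<le> c * D powr - (2 * s) / (2 * F) * (u x t - u (reflect e l x) t)"
          using v by (intro slope pos) auto
        also have "\<dots> \<le> c * D powr - (2 * s) / (2 * F) * m" using v c F by (intro mult_left_mono) auto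
        finally have "f (x \<bullet> e) * (g (u x t) - g (u (reflect e l x) t)) \<le> F * (c * D powr - (2 * s) / (2 * F) * m)"
          using fF fpos F c m by (intro mult_mono') (auto intro: g_mono pos less_imp_le[OF v(1)])
        also have "\<dots> = c / 2 * m * D powr - (2 * s)" using F by simp
        also have "\<dots> \<le> c / 2 * m * d powr - (2 * s)" using c m d dD s by (intro mult_left_mono powr_mono2') auto
        also have "\<dots> < c * m * d powr - (2 * s)" using c m d by simp
        finally show False using first by (simp add: d_def)
      qed
      have m\<mu>: "m \<le> \<mu>" using minf near by blast
      have "\<epsilon> / 2 \<le> u (reflect e l x) t" using \<open>\<epsilon> < u x t\<close> v m\<mu> by (simp add: \<mu>_def)
      then have "g (\<epsilon> / 2) \<le> g (u (reflect e l x) t)" using \<epsilon> by (intro g_mono) auto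
      moreover have "\<kappa> \<le> f (2 * l - x \<bullet> e) - f (x \<bullet> e)"
        using dD \<open>\<delta> < d\<close> x l lR d by (intro gap) (auto simp: d_def)
      ultimately have "\<kappa> * g (\<epsilon> / 2) \<le> (f (2 * l - x \<bullet> e) - f (x \<bullet> e)) * g (u (reflect e l x) t)"
        using \<kappa> g\<epsilon> by (intro mult_mono) auto
      also have "\<dots> \<le> F * (\<Lambda> * m)" by (rule order_trans[OF second mult_right_mono[OF fF]]) (use \<Lambda> m in simp)
      also have "\<dots> \<le> F * (\<Lambda> * (\<kappa> * g (\<epsilon> / 2) / (2 * F * \<Lambda>)))"
        using F \<Lambda> m\<mu> by (intro mult_left_mono) (auto simp: \<mu>_def)
      also have "\<dots> = \<kappa> * g (\<epsilon> / 2) / 2" using F \<Lambda> by simp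
      finally show False using \<kappa> g\<epsilon> by simp
    qed
    then show "\<exists>\<mu>>0. \<forall>l\<le>l0. (\<forall>x t. x \<bullet> e < l \<longrightarrow> - \<mu> \<le> u (reflect e l x) t - u x t) \<longrightarrow> plane_ok l"
      using \<mu> by blast
  qed
qed

text \<open>
By uniform continuity, moving the plane by a small \<open>\<rho>\<close> lowers the infimum of the reflected difference by
less than \<open>\<mu>\<close>, which the dichotomy does not allow unless the infimum stays \<open>0\<close>.  As \<open>\<mu>\<close> serves all planes up to \<open>l\<close>,
the step \<open>\<rho>\<close> is uniform and finitely many steps lead from the far left to \<open>l\<close>.
\<close>
lemma plane_ok_all: "plane_ok l"
proof -
  obtain R where start: "\<And>l. l \<le> - R \<Longrightarrow> plane_ok l"
    and dich: "\<And>l0. \<exists>\<mu>>0. \<forall>l\<le>l0. (\<forall>x t. x \<bullet> e < l \<longrightarrow> - \<mu> \<le> u (reflect e l x) t - u x t) \<longrightarrow> plane_ok l"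
    by (rule plane_dichotomy) blast
  obtain \<mu> where \<mu>: "\<mu> > 0"
    and close: "\<And>l'. l' \<le> l \<Longrightarrow> (\<forall>x t. x \<bullet> e < l' \<longrightarrow> - \<mu> \<le> u (reflect e l' x) t - u x t) \<Longrightarrow> plane_ok l'"
    using dich[of l] by blast
  obtain \<delta> where \<delta>: "\<delta> > 0" and ud: "\<And>x y t. dist x y < \<delta> \<Longrightarrow> \<bar>u x t - u y t\<bar> < \<mu>"
    using unif_cont[OF \<mu>] by blast
  define \<rho> where "\<rho> = \<delta> / 3"
  have \<rho>: "\<rho> > 0" "2 * \<rho> < \<delta>" using \<delta> by (auto simp: \<rho>_def)
  have ne: "norm e = 1" using e_Basis by simp
  have advance: "plane_ok b" if ok: "plane_ok a" and ab: "a \<le> b" "b \<le> a + \<rho>" "b \<le> l" for a b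
  proof (rule close[OF ab(3)], intro allI impI)
    fix x t assume x: "x \<bullet> e < b"
    show "- \<mu> \<le> u (reflect e b x) t - u x t"
    proof (cases "x \<bullet> e < a")
      case True
      have "dist (reflect e b x) (reflect e a x) = norm ((2 * (b - a)) *\<^sub>R e)"
        by (simp add: dist_norm reflect_def algebra_simps)
      also have "\<dots> < \<delta>" using ab \<rho> ne by simp
      finally have "\<bar>u (reflect e b x) t - u (reflect e a x) t\<bar> < \<mu>" by (rule ud)
      moreover have "u x t \<le> u (reflect e a x) t" using ok True by (simp add: plane_ok_def)
      ultimately show ?thesis by linarith
    next
      case False
      have "dist (reflect e b x) x = norm ((2 * (b - x \<bullet> e)) *\<^sub>R e)" by (simp add: dist_norm reflect_def)
      also have "\<dots> < \<delta>" using False x ab \<rho> ne by simp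
      finally have "\<bar>u (reflect e b x) t - u x t\<bar> < \<mu>" by (rule ud)
      then show ?thesis by linarith
    qed
  qed
  have "plane_ok (min l (- R + real j * \<rho>))" for j
  proof (induction j)
    case 0
    show ?case by (rule start) simp
  next
    case (Suc j)
    show ?case by (rule advance[OF Suc]) (use \<rho> in \<open>auto simp: min_def algebra_simps\<close>)
  qed
  moreover obtain j where "(l + R) / \<rho> < real j" using reals_Archimedean2 by blast
  then have "l \<le> - R + real j * \<rho>" using \<rho> by (simp add: field_simps)
  ultimately show ?thesis by (metis min.absorb1)
qed

lemma monotone_in_e:
  assumes "0 \<le> a"
  shows "u x t \<le> u (x + a *\<^sub>R e) t"
proof (cases "a = 0")
  case False
  define l where "l = x \<bullet> e + a / 2"
  have "x \<bullet> e < l" using False assms by (simp add: l_def)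
  moreover have "reflect e l x = x + a *\<^sub>R e" by (simp add: reflect_def l_def)
  ultimately show ?thesis using plane_ok_all[of l] by (auto simp: plane_ok_def)
qed simp

section \<open>Nonexistence\<close>

text \<open>
Monotonicity carries the positive minimum \<open>b\<close> of \<open>u\<close> over a unit cylinder at the origin to all its
translates to the right, where the source term then grows with \<open>f\<close>.
\<close>
lemma f_not_unbounded: "\<not> filterlim f at_top at_top"
proof
  assume lim: "filterlim f at_top at_top"
  obtain C where C: "C > 0" and touch:
    "\<And>x0 t0 A. \<lbrakk>\<And>x t. 0 \<le> u x t; 0 \<le> A; u x0 t0 < A\<rbrakk>
      \<Longrightarrow> \<exists>x t. norm (x - x0) \<le> 1 \<and> \<bar>t - t0\<bar> \<le> 1 \<and> master_operator s \<alpha> u x t \<le> C * A"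
    by (rule master_operator_touching_bound) blast
  let ?S = "cball (0::real^'n) 1 \<times> cball (0::real) 1"
  have "compact ?S" "?S \<noteq> {}" by (auto intro: compact_Times)
  from continuous_attains_inf[OF this continuous_u]
  obtain p where p: "\<forall>q\<in>?S. (\<lambda>(x, t). u x t) p \<le> (\<lambda>(x, t). u x t) q" by blast
  define b where "b = u (fst p) (snd p)"
  have b: "b > 0" "b \<le> u x t" if "norm x \<le> 1" "\<bar>t\<bar> \<le> 1" for x t
    using p[rule_format, of "(x, t)"] that pos by (auto simp: b_def case_prod_beta)
  have b0: "b > 0" using b(1)[of 0 0] by simp
  have gb: "g b > 0" using b0 by (rule g_pos)
  have M: "M > 0" using less_le_trans[OF pos u_le] .
  obtain r where r: "r \<ge> 0" "f r > C * (M + 1) / g b"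
  proof -
    have "eventually (\<lambda>r. C * (M + 1) / g b < f r) at_top" using lim by (simp add: filterlim_at_top_dense)
    then obtain N where "\<And>r. r \<ge> N \<Longrightarrow> C * (M + 1) / g b < f r" by (auto simp: eventually_at_top_linorder)
    then show ?thesis using that[of "max N 0"] by simp
  qed
  have fr: "f r > 0" using less_trans[OF _ r(2), of 0] C M gb by simp
  obtain x t where x: "norm (x - (r + 1) *\<^sub>R e) \<le> 1" and t: "\<bar>t - 0\<bar> \<le> 1" and le: "master_operator s \<alpha> u x t \<le> C * (M + 1)"
  proof -
    have "u ((r + 1) *\<^sub>R e) 0 < M + 1" using u_le[of "(r + 1) *\<^sub>R e" 0] by simp
    from touch[OF less_imp_le[OF pos] _ this] M show ?thesis using that by auto
  qed
  have "b \<le> u (x - (r + 1) *\<^sub>R e) t" using b(2)[of "x - (r + 1) *\<^sub>R e" t] x t by simp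
  also have "\<dots> \<le> u x t" using monotone_in_e[of "r + 1" "x - (r + 1) *\<^sub>R e" t] r by simp
  finally have "g b \<le> g (u x t)" by (rule g_mono[OF b0])
  moreover have "f r \<le> f (x \<bullet> e)"
  proof (rule f_mono)
    have "\<bar>(x - (r + 1) *\<^sub>R e) \<bullet> e\<bar> \<le> 1" using Basis_le_norm[OF e_Basis, of "x - (r + 1) *\<^sub>R e"] x by linarith
    then show "r \<le> x \<bullet> e" using e_Basis by (simp add: inner_diff_left)
  qed
  ultimately have "f r * g b \<le> f (x \<bullet> e) * g (u x t)" using fr gb by (intro mult_mono) auto
  also have "\<dots> \<le> C * (M + 1)" using le by (simp add: equation inner_e)
  finally show False using r(2) gb by (simp add: field_simps)
qed

end

theorem theorem1p6:
  fixes k :: "'n::finite"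
    and s \<alpha> :: real
    and f g :: "real \<Rightarrow> real"
  assumes "0 < s" and "s < 1"
    and "0 < \<alpha>" and "\<alpha> \<le> 1"
    and "condition_F1 s f"
    and "condition_F2 g"
    and "filterlim f at_top at_top"
  shows "\<not> (\<exists>u :: real^'n \<Rightarrow> real \<Rightarrow> real.
           classical_solution k s \<alpha> f g u \<and>
           (\<forall>x t. u x t > 0) \<and>
           bounded (range (\<lambda>(x, t). u x t)) \<and>
           uniformly_continuous_on UNIV (\<lambda>(x, t). u x t))"
proof
  assume "\<exists>u :: real^'n \<Rightarrow> real \<Rightarrow> real.
           classical_solution k s \<alpha> f g u \<and>
           (\<forall>x t. u x t > 0) \<and>
           bounded (range (\<lambda>(x, t). u x t)) \<and>
           uniformly_continuous_on UNIV (\<lambda>(x, t). u x t)"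
  then obtain u :: "real^'n \<Rightarrow> real \<Rightarrow> real" where sol: "classical_solution k s \<alpha> f g u"
    and pos: "\<And>x t. u x t > 0" and bdd: "bounded (range (\<lambda>(x, t). u x t))"
    and unif: "uniformly_continuous_on UNIV (\<lambda>(x, t). u x t)" by blast
  obtain M where M: "\<And>x t. \<bar>u x t\<bar> \<le> M" using bdd by (auto simp: bounded_iff)
  interpret positive_solution s \<alpha> M u k f g
    by unfold_locales (use assms sol pos M unif in \<open>auto simp: classical_solution_def master_operator_def\<close>)
  show False using f_not_unbounded assms(7) by blast
qed

end
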